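(* Let $\mu=(\alpha_1,\ldots,\alpha_n\,|\,\beta_1,\ldots,\beta_n)$ be a partition in Frobenius notation, and set $$A=(a_1,\ldots,a_n):=(\alpha_1+1,\ldots,\alpha_n+1),\quad B:=(\beta_1,\ldots,\beta_n),$$ $$C=(c_1,\ldots,c_n):=(\beta_1+1,\ldots,\beta_n+1),\quad D:=(\alpha_1,\ldots,\alpha_n).$$ Then $$ 2^n\,\overline f^{\mu}=\sum \overline g^{(a_{i_1},\ldots,a_{i_k})}\ \overline g^{A\#B\smallsetminus(a_{i_1},\ldots,a_{i_k})} =\sum \overline g^{(c_{i_1},\ldots,c_{i_k})}\ \overline g^{C\#D\smallsetminus(c_{i_1},\ldots,c_{i_k})}, $$ where the sums are over all sequences $1\le i_1<\cdots<i_k\le n$, $k=0,1,\ldots,n$, for which $A\#B\smallsetminus(a_{i_1},\ldots,a_{i_k})$ (resp. $C\#D\smallsetminus(c_{i_1},\ldots,c_{i_k})$) is a sequence of different integers.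
   Context: Frobenius notation: $\alpha_1>\cdots>\alpha_n\ge 0$ and $\beta_1>\cdots>\beta_n\ge0$, where $n$ is the length of the main diagonal of the diagram of $\mu$, $\alpha_j=\mu_j-j$ and $\beta_j=\mu^{\sim}_j-j$, with $\mu^{\sim}$ the conjugate partition. For sequences $X=(x_1,\ldots,x_n)$ and $Y=(y_1,\ldots,y_n)$, $X\#Y$ denotes the interleaved sequence $(x_1,y_1,x_2,y_2,\ldots,x_n,y_n)$, and $X\#Y\smallsetminus(x_{i_1},\ldots,x_{i_k})$ is the sequence obtained from $X\#Y$ by deleting the entries coming from $X$ with indices $i_1,\ldots,i_k$ (keeping the order of the remaining entries). For a partition $\mu$, $\overline f^{\mu}:=\prod_{x\in\mu}\frac1{h(x)}$, where for a square $x=(i,j)$ of the diagram of $\mu$ the hook-length is $h(x)=\mu_i+\mu^{\sim}_j-i-j+1$. For a strict partition $\lambda$, $\overline g^{\lambda}:=\prod_{x\in S(\lambda)}\frac1{h(x)}$, where $S(\lambda)$ is the shifted diagram of $\lambda$, regarded as the set of squares $(i,j)$ with $j>i$ in the double diagram, i.e. in the diagram of the partition with Frobenius notation $(\lambda_1,\lambda_2,\ldots\,|\,\lambda_1-1,\lambda_2-1,\ldots)$, and $h(x)$ is the hook-length at $x$ in this double diagram. Equivalently, $\overline g^{\lambda}=\frac{1}{\prod_{i\ge1}\lambda_i!}\prod_{i<j}\frac{\lambda_i-\lambda_j}{\lambda_i+\lambda_j}$, where the products run over the nonzero parts of $\lambda$; and $\overline g^{\emptyset}=1$. For a sequence $K=(k_1,\ldots,k_l)$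 of different positive integers, let $w_K\in S_l$ be the permutation with $k_{w_K(1)}>\cdots>k_{w_K(l)}$ and let $\langle K\rangle$ be this decreasing rearrangement; set $\overline g^{K}:=\operatorname{sgn}(w_K)\,\overline g^{\langle K\rangle}$. If a sequence occurring in the statement has an entry $0$, that entry is necessarily the last one and is dropped. *)

theory Defs
  imports Complex_Main "HOL-Combinatorics.Permutations"
begin

definition is_partition :: "nat list \<Rightarrow> bool" where
  "is_partition mu \<longleftrightarrow> sorted_wrt (\<ge>) mu \<and> 0 \<notin> set mu"

(* Rows, columns and squares are indexed from 1; lists are indexed from 0. *)

definition part :: "nat list \<Rightarrow> nat \<Rightarrow> nat" where
  "part mu i = (if 1 \<le> i \<and> i \<le> length mu then mu ! (i - 1) else 0)"

definition conj_part :: "nat list \<Rightarrow> nat \<Rightarrow> nat" where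
  "conj_part mu j = card {i. 1 \<le> i \<and> i \<le> length mu \<and> j \<le> part mu i}"

definition diagram :: "nat list \<Rightarrow> (nat \<times> nat) set" where
  "diagram mu = {(i, j). 1 \<le> i \<and> i \<le> length mu \<and> 1 \<le> j \<and> j \<le> part mu i}"

(* On squares of the diagram the natural-number subtractions do not truncate. *)
definition hook :: "nat list \<Rightarrow> nat \<times> nat \<Rightarrow> nat" where
  "hook mu x = (case x of (i, j) \<Rightarrow> part mu i + conj_part mu j + 1 - i - j)"

definition diag_len :: "nat list \<Rightarrow> nat" where
  "diag_len mu = card {i. (i, i) \<in> diagram mu}"

definition frob_alpha :: "nat list \<Rightarrow> nat list" where
  "frob_alpha mu = map (\<lambda>j. part mu j - j) [1..<Suc (diag_len mu)]"

definition frob_beta :: "nat list \<Rightarrow> nat list" where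
  "frob_beta mu = map (\<lambda>j. conj_part mu j - j) [1..<Suc (diag_len mu)]"

(* The partition with Frobenius notation (al | be): it has hd be + 1 rows. Row i has length
   al_i + i if it meets the main diagonal; otherwise its length is the number of columns
   j \<le> n that reach down to it, column j having length be_j + j. The lemmas
   of_frobenius_correct and of_frobenius_unique below characterise it. *)
definition of_frobenius :: "nat list \<Rightarrow> nat list \<Rightarrow> nat list" where
  "of_frobenius al be =
     map (\<lambda>i. if i \<le> length al then al ! (i - 1) + i
              else card {j. 1 \<le> j \<and> j \<le> length be \<and> i \<le> be ! (j - 1) + j})
         [1..<Suc (if be = [] then 0 else hd be + 1)]"

definition f_bar :: "nat list \<Rightarrow> real" where
  "f_bar mu = (\<Prod>x\<in>diagram mu. 1 / real (hook mu x))"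

definition double_partition :: "nat list \<Rightarrow> nat list" where
  "double_partition lam = of_frobenius lam (map (\<lambda>l. l - 1) lam)"

definition shifted_diagram :: "nat list \<Rightarrow> (nat \<times> nat) set" where
  "shifted_diagram lam = {(i, j). (i, j) \<in> diagram (double_partition lam) \<and> i < j}"

(* Intended for strict partitions, i.e. strictly decreasing lists of positive integers. *)
definition g_bar :: "nat list \<Rightarrow> real" where
  "g_bar lam = (\<Prod>x\<in>shifted_diagram lam. 1 / real (hook (double_partition lam) x))"

(* w_K, as a permutation of the 0-based positions {..<length K}. *)
definition sort_perm :: "nat list \<Rightarrow> nat \<Rightarrow> nat" where
  "sort_perm K = (THE w. w permutes {..<length K} \<and>
                         sorted_wrt (>) (map (\<lambda>i. K ! w i) [0..<length K]))"

definition decr_rearr :: "nat list \<Rightarrow> nat list" where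
  "decr_rearr K = map (\<lambda>i. K ! sort_perm K i) [0..<length K]"

(* Extension of g_bar to sequences of different positive integers. *)
definition g_bar_pos :: "nat list \<Rightarrow> real" where
  "g_bar_pos K = of_int (sign (sort_perm K)) * g_bar (decr_rearr K)"

(* An entry 0 is dropped before the sequence is sorted. *)
definition g_bar_seq :: "nat list \<Rightarrow> real" where
  "g_bar_seq K = g_bar_pos (removeAll 0 K)"

(* For lists of equal length, splice X Y is the interleaving X#Y, with the entry X ! i at
   position 2 * i. The entries of X with (0-based) index in I are deleted. *)
definition interleave_del :: "nat list \<Rightarrow> nat list \<Rightarrow> nat set \<Rightarrow> nat list" where
  "interleave_del X Y I = nths (splice X Y) {p. \<not> (\<exists>i\<in>I. p = 2 * i)}"

lemma strict_decr_nth_add: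
  fixes xs :: "nat list"
  assumes "sorted_wrt (>) xs" and "i \<le> j" and "j < length xs"
  shows "xs ! j + (j - i) \<le> xs ! i"
  using assms(2,3)
proof (induction j rule: dec_induct)
  case base
  then show ?case by simp
next
  case (step k)
  have "xs ! k > xs ! Suc k"
    using assms(1) step.prems by (auto simp: sorted_wrt_iff_nth_less)
  with step show ?case by auto
qed

lemma length_of_frobenius:
  "length (of_frobenius al be) = (if be = [] then 0 else hd be + 1)"
  by (simp add: of_frobenius_def)

lemma part_of_frobenius:
  assumes "1 \<le> i" and "i \<le> length (of_frobenius al be)"
  shows "part (of_frobenius al be) i =
    (if i \<le> length al then al ! (i - 1) + i
     else card {j. 1 \<le> j \<and> j \<le> length be \<and> i \<le> be ! (j - 1) + j})"
  using assms by (simp add: part_def of_frobenius_def nth_append del: upt_Suc split: if_splits)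

lemma of_frobenius_correct:
  assumes al: "sorted_wrt (>) al" and be: "sorted_wrt (>) be" and len: "length al = length be"
  shows "is_partition (of_frobenius al be)"
    and "diag_len (of_frobenius al be) = length al"
    and "frob_alpha (of_frobenius al be) = al"
    and "frob_beta (of_frobenius al be) = be"
proof -
  define n where "n = length be"
  define L where "L = of_frobenius al be"
  define r where "r = length L"
  define c where "c i = {j. 1 \<le> j \<and> j \<le> n \<and> i \<le> be ! (j - 1) + j}" for i
  have lal: "length al = n" using len n_def by simp
  have a_mono: "al ! (j - 1) + j \<le> al ! (i - 1) + i" if "1 \<le> i" "i \<le> j" "j \<le> n" for i j
  proof -
    have "al ! (j - 1) + (j - 1 - (i - 1)) \<le> al ! (i - 1)"
      using that lal by (intro strict_decr_nth_add[OF al]) auto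
    then show ?thesis using that by linarith
  qed
  have b_mono: "be ! (j - 1) + j \<le> be ! (i - 1) + i" if "1 \<le> i" "i \<le> j" "j \<le> n" for i j
  proof -
    have "be ! (j - 1) + (j - 1 - (i - 1)) \<le> be ! (i - 1)"
      using that n_def by (intro strict_decr_nth_add[OF be]) auto
    then show ?thesis using that by linarith
  qed
  have b_ge: "n \<le> be ! (i - 1) + i" if "1 \<le> i" "i \<le> n" for i
    using b_mono[of i n] that by auto
  have r_eq: "r = (if n = 0 then 0 else be ! 0 + 1)"
    by (auto simp: r_def L_def length_of_frobenius n_def hd_conv_nth)
  have n_le: "n \<le> r" using b_ge[of 1] r_eq by (cases "n = 0") auto
  have b_le: "be ! (i - 1) + i \<le> r" if "1 \<le> i" "i \<le> n" for i
    using b_mono[of 1 i] that r_eq by auto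
  have P1: "part L i = al ! (i - 1) + i" if "1 \<le> i" "i \<le> n" for i
    using part_of_frobenius[of i al be] that n_le lal unfolding L_def r_def by auto
  have P2: "part L i = card (c i)" if "n < i" "i \<le> r" for i
    using part_of_frobenius[of i al be] that lal
    unfolding L_def[symmetric] r_def[symmetric] c_def n_def[symmetric] by auto
  have cfin: "c i \<subseteq> {1..n}" for i unfolding c_def by auto
  have cfin': "finite (c i)" for i using cfin finite_subset by blast
  have c_le: "card (c i) \<le> n" for i using card_mono[OF _ cfin, of i] by simp
  have c_anti: "card (c j) \<le> card (c i)" if "i \<le> j" for i j
    using that by (intro card_mono cfin') (auto simp: c_def)
  have c_pos: "card (c i) > 0" if "n < i" "i \<le> r" for i
  proof -
    have "1 \<in> c i" using that r_eq unfolding c_def by (auto split: if_splits)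
    then show ?thesis using cfin' card_gt_0_iff by blast
  qed
  have c_ge: "j \<le> card (c i) \<longleftrightarrow> i \<le> be ! (j - 1) + j" if "1 \<le> j" "j \<le> n" for i j
  proof
    assume "i \<le> be ! (j - 1) + j"
    then have "{1..j} \<subseteq> c i" using that b_mono unfolding c_def by fastforce
    from card_mono[OF cfin' this] show "j \<le> card (c i)" by simp
  next
    assume *: "j \<le> card (c i)"
    show "i \<le> be ! (j - 1) + j"
    proof (rule ccontr)
      assume n: "\<not> i \<le> be ! (j - 1) + j"
      have "c i \<subseteq> {1..<j}"
      proof
        fix k assume "k \<in> c i"
        then have k: "1 \<le> k" "k \<le> n" "i \<le> be ! (k - 1) + k" by (auto simp: c_def)
        have "k < j" using b_mono[of j k] that k n by (cases "k < j") auto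
        then show "k \<in> {1..<j}" using k by auto
      qed
      from card_mono[OF _ this] have "card (c i) \<le> j - 1" by simp
      with * that show False by auto
    qed
  qed
  have mono: "part L j \<le> part L i" if "1 \<le> i" "i \<le> j" "j \<le> r" for i j
  proof (cases "j \<le> n")
    case True
    then show ?thesis using a_mono P1 that by auto
  next
    case False
    show ?thesis
    proof (cases "i \<le> n")
      case True
      have "n \<le> al ! (i - 1) + i" using a_mono[of i n] that True by auto
      moreover have "part L i = al ! (i - 1) + i" using that True P1 by blast
      moreover have "part L j = card (c j)" using that \<open>\<not> j \<le> n\<close> P2 by simp
      ultimately show ?thesis using c_le[of j] by linarith
    next
      case False
      then show ?thesis using P2 c_anti that by auto
    qed
  qed
  have pos: "0 < part L i" if "1 \<le> i" "i \<le> r" for i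
    using that P1[of i] P2[of i] c_pos[of i] by (cases "i \<le> n") auto
  have nthL: "L ! i = part L (Suc i)" if "i < r" for i
    using that by (simp add: part_def r_def)
  show "is_partition (of_frobenius al be)"
    unfolding L_def[symmetric] is_partition_def
  proof
    show "sorted_wrt (\<ge>) L"
      using mono by (auto simp: sorted_wrt_iff_nth_less nthL r_def[symmetric])
    show "0 \<notin> set L"
    proof
      assume "0 \<in> set L"
      then obtain i where "i < r" "L ! i = 0" by (auto simp: in_set_conv_nth r_def)
      then show False using nthL[of i] pos[of "Suc i"] by auto
    qed
  qed
  have "{i. (i, i) \<in> diagram L} = {1..n}"
  proof (intro set_eqI iffI)
    fix i assume "i \<in> {i. (i, i) \<in> diagram L}"
    then have i: "1 \<le> i" "i \<le> r" "i \<le> part L i" by (auto simp: diagram_def r_def)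
    then show "i \<in> {1..n}" using P2[of i] c_le[of i] by (cases "i \<le> n") auto
  next
    fix i assume "i \<in> {1..n}"
    then show "i \<in> {i. (i, i) \<in> diagram L}"
      using P1[of i] n_le by (auto simp: diagram_def r_def[symmetric])
  qed
  then have d: "diag_len L = n" by (simp add: diag_len_def)
  then show "diag_len (of_frobenius al be) = length al" by (simp add: L_def lal)
  show "frob_alpha (of_frobenius al be) = al"
    unfolding L_def[symmetric]
    by (rule nth_equalityI) (auto simp: frob_alpha_def d lal P1 simp del: upt_Suc)
  have "conj_part L j = be ! (j - 1) + j" if "1 \<le> j" "j \<le> n" for j
  proof -
    have "{i. 1 \<le> i \<and> i \<le> length L \<and> j \<le> part L i} = {1..be ! (j - 1) + j}"
    proof (intro set_eqI iffI)
      fix i assume "i \<in> {i. 1 \<le> i \<and> i \<le> length L \<and> j \<le> part L i}"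
      then have i: "1 \<le> i" "i \<le> r" "j \<le> part L i" by (auto simp: r_def)
      show "i \<in> {1..be ! (j - 1) + j}"
        using i b_ge[of j] that P2[of i] c_ge[of j i] by (cases "i \<le> n") auto
    next
      fix i assume "i \<in> {1..be ! (j - 1) + j}"
      then have i: "1 \<le> i" "i \<le> be ! (j - 1) + j" by auto
      have ir: "i \<le> r" using b_le[of j] that i by auto
      have "j \<le> part L i"
      proof (cases "i \<le> n")
        case True
        show ?thesis
          using P1[of i] a_mono[of i j] i True that by (cases "i \<le> j") auto
      next
        case False
        then show ?thesis using P2[of i] ir c_ge[of j i] i that by auto
      qed
      then show "i \<in> {i. 1 \<le> i \<and> i \<le> length L \<and> j \<le> part L i}"
        using i ir by (auto simp: r_def)
    qed
    then show ?thesis by (simp add: conj_part_def)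
  qed
  then show "frob_beta (of_frobenius al be) = be"
    unfolding L_def[symmetric]
    by (intro nth_equalityI) (auto simp: frob_beta_def d n_def simp del: upt_Suc)
qed

lemma of_frobenius_unique:
  assumes "is_partition mu"
  shows "of_frobenius (frob_alpha mu) (frob_beta mu) = mu"
proof -
  define r where "r = length mu"
  define n where "n = diag_len mu"
  have mono: "part mu j \<le> part mu i" if "1 \<le> i" "i \<le> j" for i j
    using assms that
    by (cases "i = j") (auto simp: is_partition_def part_def sorted_wrt_iff_nth_less)
  have pos: "0 < part mu i" if "1 \<le> i" "i \<le> r" for i
    using assms that by (auto simp: is_partition_def part_def r_def in_set_conv_nth Suc_le_eq)
  have out: "part mu i = 0" if "r < i" for i using that by (simp add: part_def r_def)
  have init: "{i. 1 \<le> i \<and> i \<le> r \<and> Q i} = {1..card {i. 1 \<le> i \<and> i \<le> r \<and> Q i}}"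
    if "\<And>i j. 1 \<le> i \<Longrightarrow> i \<le> j \<Longrightarrow> j \<le> r \<Longrightarrow> Q j \<Longrightarrow> Q i" for Q
  proof -
    let ?S = "{i. 1 \<le> i \<and> i \<le> r \<and> Q i}"
    have fin: "finite ?S" by simp
    have "\<exists>m. ?S = {1..m}"
    proof (cases "?S = {}")
      case False
      have "Max ?S \<in> ?S" using Max_in[OF fin False] .
      then have M: "1 \<le> Max ?S" "Max ?S \<le> r" "Q (Max ?S)" by blast+
      have "?S = {1..Max ?S}"
      proof (intro equalityI subsetI)
        fix i assume i: "i \<in> ?S"
        with Max_ge[OF fin i] show "i \<in> {1..Max ?S}" by simp
      next
        fix i assume "i \<in> {1..Max ?S}"
        then have "1 \<le> i" "i \<le> Max ?S" by auto
        with M that[of i "Max ?S"] show "i \<in> ?S" by (simp del: Max_ge_iff Max_le_iff)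
      qed
      then show ?thesis by blast
    qed (auto intro: exI[of _ 0])
    then obtain m where "?S = {1..m}" by blast
    then show ?thesis by simp
  qed
  have diag: "1 \<le> i \<and> i \<le> r \<and> i \<le> part mu i \<longleftrightarrow> 1 \<le> i \<and> i \<le> n" for i
  proof -
    have "{i. (i, i) \<in> diagram mu} = {i. 1 \<le> i \<and> i \<le> r \<and> i \<le> part mu i}"
      by (auto simp: diagram_def r_def)
    moreover have "{i. 1 \<le> i \<and> i \<le> r \<and> i \<le> part mu i}
        = {1..card {i. 1 \<le> i \<and> i \<le> r \<and> i \<le> part mu i}}"
      by (rule init) (meson le_trans mono)
    ultimately have "{i. 1 \<le> i \<and> i \<le> r \<and> i \<le> part mu i} = {1..n}"
      by (simp add: n_def diag_len_def)
    then show ?thesis by (auto simp: set_eq_iff)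
  qed
  have conj: "1 \<le> i \<and> i \<le> r \<and> j \<le> part mu i \<longleftrightarrow> 1 \<le> i \<and> i \<le> conj_part mu j" for i j
  proof -
    have "{i. 1 \<le> i \<and> i \<le> r \<and> j \<le> part mu i}
        = {1..card {i. 1 \<le> i \<and> i \<le> r \<and> j \<le> part mu i}}"
      by (rule init) (meson le_trans mono)
    then have "{i. 1 \<le> i \<and> i \<le> r \<and> j \<le> part mu i} = {1..conj_part mu j}"
      by (simp add: conj_part_def r_def)
    then show ?thesis by (auto simp: set_eq_iff)
  qed
  have al: "length (frob_alpha mu) = n" by (simp add: frob_alpha_def n_def)
  have be: "length (frob_beta mu) = n" by (simp add: frob_beta_def n_def)
  have aln: "frob_alpha mu ! (i - 1) + i = part mu i" if "1 \<le> i" "i \<le> n" for i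
  proof -
    have "frob_alpha mu ! (i - 1) = part mu i - i"
      using that by (auto simp: frob_alpha_def n_def simp del: upt_Suc)
    moreover have "i \<le> part mu i" using diag[of i] that by blast
    ultimately show ?thesis by simp
  qed
  have ben: "frob_beta mu ! (i - 1) + i = conj_part mu i" if "1 \<le> i" "i \<le> n" for i
  proof -
    have "frob_beta mu ! (i - 1) = conj_part mu i - i"
      using that by (auto simp: frob_beta_def n_def simp del: upt_Suc)
    moreover have "i \<le> conj_part mu i" using diag[of i] conj[of i i] that by blast
    ultimately show ?thesis by simp
  qed
  have n_pos: "1 \<le> n" if "1 \<le> r" using diag[of 1] pos[of 1] that by simp
  have len: "length (of_frobenius (frob_alpha mu) (frob_beta mu)) = r"
  proof (cases "n = 0")
    case True
    then have "r = 0" using n_pos by (cases r) auto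
    with True be show ?thesis by (simp add: length_of_frobenius)
  next
    case False
    then have "frob_beta mu \<noteq> []" using be by auto
    then have "length (of_frobenius (frob_alpha mu) (frob_beta mu)) = conj_part mu 1"
      using ben[of 1] False by (simp add: length_of_frobenius hd_conv_nth)
    also have "\<dots> = r"
    proof -
      have "i \<le> r \<longleftrightarrow> i \<le> conj_part mu 1" if "1 \<le> i" for i
        using conj[of i 1] pos[of i] that by (auto simp: Suc_le_eq)
      then show ?thesis by (metis le_antisym less_one linorder_not_less nat_le_linear order_refl)
    qed
    finally show ?thesis .
  qed
  show ?thesis
  proof (rule nth_equalityI)
    show "length (of_frobenius (frob_alpha mu) (frob_beta mu)) = length mu"
      using len r_def by simp
    fix k assume "k < length (of_frobenius (frob_alpha mu) (frob_beta mu))"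
    then have k: "Suc k \<le> r" using len by simp
    let ?L = "of_frobenius (frob_alpha mu) (frob_beta mu)"
    have "part ?L (Suc k) = part mu (Suc k)"
    proof (cases "Suc k \<le> n")
      case True
      then show ?thesis using part_of_frobenius[of "Suc k"] k len al aln[of "Suc k"] by auto
    next
      case False
      have "part ?L (Suc k) = card {j. 1 \<le> j \<and> j \<le> n \<and> Suc k \<le> frob_beta mu ! (j - 1) + j}"
        using part_of_frobenius[of "Suc k"] k len al be False by auto
      also have "{j. 1 \<le> j \<and> j \<le> n \<and> Suc k \<le> frob_beta mu ! (j - 1) + j}
          = {1..part mu (Suc k)}"
      proof (intro set_eqI iffI)
        fix j assume "j \<in> {j. 1 \<le> j \<and> j \<le> n \<and> Suc k \<le> frob_beta mu ! (j - 1) + j}"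
        then show "j \<in> {1..part mu (Suc k)}" using ben[of j] conj[of "Suc k" j] by auto
      next
        fix j assume j: "j \<in> {1..part mu (Suc k)}"
        have "part mu (Suc k) < Suc k" using diag[of "Suc k"] False k by auto
        then have "j \<le> Suc k" "j \<le> r" using j k by auto
        then have "j \<le> part mu j" using mono[of j "Suc k"] j by auto
        then have "j \<le> n" using diag[of j] j \<open>j \<le> r\<close> by auto
        then show "j \<in> {j. 1 \<le> j \<and> j \<le> n \<and> Suc k \<le> frob_beta mu ! (j - 1) + j}"
          using ben[of j] conj[of "Suc k" j] j k by auto
      qed
      finally show ?thesis by simp
    qed
    then show "?L ! k = mu ! k" using k len by (simp add: part_def r_def)
  qed
qed

lemma sort_perm_ex1:
  fixes K :: "nat list"
  assumes "distinct K"
  shows "\<exists>!w. w permutes {..<length K} \<and> sorted_wrt (>) (map (\<lambda>i. K ! w i) [0..<length K])"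
proof -
  let ?T = "rev (sort K)"
  have sortT: "sorted_wrt (>) ?T"
    using assms by (simp add: sorted_wrt_rev strict_sorted_iff)
  have uniq: "map (\<lambda>i. K ! w i) [0..<length K] = ?T"
    if "w permutes {..<length K}" "sorted_wrt (>) (map (\<lambda>i. K ! w i) [0..<length K])" for w
  proof -
    let ?M = "map (\<lambda>i. K ! w i) [0..<length K]"
    have "set ?M = (!) K ` (w ` {..<length K})" by (auto simp: image_iff)
    also have "\<dots> = set K"
      unfolding permutes_image[OF that(1)] by (auto simp: in_set_conv_nth image_iff)
    finally have "set (rev ?M) = set (sort K)" by simp
    moreover have "sorted_wrt (<) (rev ?M)" using that(2) by (simp only: sorted_wrt_rev)
    moreover have "sorted_wrt (<) (sort K)" using assms by (simp add: strict_sorted_iff)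
    ultimately have "rev ?M = sort K" by (metis strict_sorted_equal)
    then show ?thesis by (metis rev_rev_ident)
  qed
  have "mset ?T = mset K" by simp
  then obtain w where w: "w permutes {..<length K}" "permute_list w K = ?T"
    by (metis mset_eq_permutation)
  show ?thesis
  proof (rule ex1I[of _ w])
    show "w permutes {..<length K} \<and> sorted_wrt (>) (map (\<lambda>i. K ! w i) [0..<length K])"
      using w sortT by (simp add: permute_list_def)
  next
    fix v assume v: "v permutes {..<length K} \<and>
      sorted_wrt (>) (map (\<lambda>i. K ! v i) [0..<length K])"
    have eq: "map (\<lambda>i. K ! v i) [0..<length K] = map (\<lambda>i. K ! w i) [0..<length K]"
      using uniq[of v] v w(2) by (simp add: permute_list_def)
    show "v = w"
    proof
      fix i
      show "v i = w i"
      proof (cases "i < length K")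
        case True
        then have "K ! v i = K ! w i" using arg_cong[OF eq, of "\<lambda>l. l ! i"] by simp
        moreover have "v i < length K" "w i < length K"
          using True v w(1) permutes_in_image by fastforce+
        ultimately show ?thesis using assms nth_eq_iff_index_eq by blast
      next
        case False
        then show ?thesis using v w(1) by (simp add: permutes_def)
      qed
    qed
  qed
qed

lemma g_bar_seq_strict:
  assumes "sorted_wrt (>) lam" and "0 \<notin> set lam"
  shows "g_bar_seq lam = g_bar lam"
proof -
  have "sorted_wrt (<) (rev lam)" using assms(1) by (simp add: sorted_wrt_rev)
  then have "distinct (rev lam)" by (simp only: strict_sorted_iff)
  then have "distinct lam" by simp
  from sort_perm_ex1[OF this] have "sort_perm lam = id"
    unfolding sort_perm_def using assms(1)
    by (intro the1_equality) (auto simp: permutes_id map_nth)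
  then show ?thesis
    using assms(2) by (simp add: g_bar_seq_def g_bar_pos_def decr_rearr_def map_nth sign_id)
qed

end

theory Submission
  imports Defs "HOL-Computational_Algebra.Polynomial"
begin

text \<open>
  Both expansions are one identity between rational functions. The hook-length products have closed
  forms. If the main diagonal has length \<open>n\<close> and \<open>i \<le> n\<close>, then the hooks of row \<open>i\<close> in the columns
  beyond \<open>n\<close> and the differences \<open>\<alpha>\<^sub>i - \<alpha>\<^sub>k\<close> with \<open>i < k \<le> n\<close> together are the numbers \<open>1, \<dots>, \<alpha>\<^sub>i\<close>,
  each once (\<open>hook_row_beyond_square\<close>). Hence, for
  Frobenius coordinates \<open>\<alpha>\<close>, \<open>\<beta>\<close>, the product \<open>f_bar\<close> is the Cauchy-determinant expression
  \<open>\<Prod>\<^bsub>i<j\<^esub> (\<alpha>\<^sub>i - \<alpha>\<^sub>j) (\<beta>\<^sub>i - \<beta>\<^sub>j) / (\<Prod>\<^bsub>i,j\<^esub> (\<alpha>\<^sub>i + \<beta>\<^sub>j + 1) \<Prod>\<^bsub>i\<^esub> \<alpha>\<^sub>i! \<beta>\<^sub>i!)\<close>, which is symmetric in \<open>\<alpha>\<close> and \<open>\<beta>\<close>;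
  so the second expansion is the first one for the conjugate partition. On the other side
  \<open>g_bar_seq K\<close> is \<open>\<Prod>\<^bsub>i\<^esub> 1 / k\<^sub>i! \<Prod>\<^bsub>i<j\<^esub> (k\<^sub>i - k\<^sub>j) / (k\<^sub>i + k\<^sub>j)\<close>: this expression is antisymmetric, which
  accounts for the sign of the sorting permutation, it vanishes at sequences with a repetition, so that
  the sum may run over all index sets, and a final entry \<open>0\<close> contributes the factor \<open>1\<close>.

  Write \<open>a\<^sub>i = \<alpha>\<^sub>i + 1\<close> and \<open>b\<^sub>i = \<beta>\<^sub>i\<close>. In the summand for the index set \<open>I\<close> with complement \<open>J\<close>, the
  factorials and the factors among the \<open>b\<^sub>k\<close> are common to all summands. The position of \<open>a\<^sub>j\<close> among the
  \<open>b\<^sub>k\<close> in the interleaving gives the sign \<open>(-1)\<^sup>j\<close> (counting \<open>j\<close> from 0), so that \<open>a\<^sub>j\<close> contributes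
  \<open>(-1)\<^sup>j \<phi>(a\<^sub>j)\<close> with \<open>\<phi>(x) = \<Prod>\<^bsub>k\<^esub> (x - b\<^sub>k) / (x + b\<^sub>k)\<close>. Dividing by the product of
  \<open>(a\<^sub>i - a\<^sub>j) / (a\<^sub>i + a\<^sub>j)\<close> over all \<open>i < j\<close> turns the claim into an identity that is symmetric in the \<open>a\<^sub>i\<close>:
  the sum over all \<open>J\<close> of
  \<open>(-1)\<^bsup>|J| (|J| - 1) / 2\<^esup> \<Prod>\<^bsub>j\<in>J\<^esub> \<phi>(a\<^sub>j) \<Prod>\<^bsub>j\<in>J, i\<in>I\<^esub> (a\<^sub>j + a\<^sub>i) / (a\<^sub>j - a\<^sub>i)\<close> equals
  \<open>2\<^sup>n \<Prod>\<^bsub>i\<^esub> a\<^sub>i \<Prod>\<^bsub>i<j\<^esub> (a\<^sub>i + a\<^sub>j) (b\<^sub>i + b\<^sub>j) / \<Prod>\<^bsub>i,k\<^esub> (a\<^sub>i + b\<^sub>k)\<close> (\<open>split_sum\<close>).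

  The identity is proved by induction on \<open>n\<close>, as an identity in one of the variables, \<open>x = a\<^sub>n\<close>.
  Multiplied by \<open>\<Prod>\<^bsub>i<n\<^esub> (x - a\<^sub>i) \<Prod>\<^bsub>k\<^esub> (x + b\<^sub>k)\<close>, the sum becomes \<open>w(x) - w(-x)\<close> for a polynomial \<open>w\<close>,
  because moving \<open>x\<close> from \<open>I\<close> to \<open>J\<close> amounts to replacing \<open>x\<close> by \<open>-x\<close> in the numerator and changing its sign
  (\<open>half_num_odd_part\<close>). The claimed value becomes a constant multiple of \<open>x \<Prod>\<^bsub>i<n\<^esub> (x\<^sup>2 - a\<^sub>i\<^sup>2)\<close>. Both
  polynomials have degree at most \<open>2n - 1\<close>, and they agree at \<open>2n\<close> distinct points: at \<open>0\<close>; at each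
  \<open>-a\<^sub>i\<close>, where both vanish since the summands cancel in pairs (\<open>half_num_even_at_a\<close>); and at each
  \<open>b\<^sub>k\<close>, where \<open>\<phi>(b\<^sub>k) = 0\<close> forces \<open>x\<close> into \<open>I\<close> and what is left is the identity for \<open>n - 1\<close>
  variables (\<open>half_num_at_b\<close>). The points are distinct for positive \<open>b\<^sub>k\<close>; the case \<open>b\<^sub>n = 0\<close> follows by
  continuity.
\<close>

section \<open>Products over pairs of indices\<close>

definition pairs :: "nat set \<Rightarrow> (nat \<times> nat) set" where
  "pairs X = {(i, j). i \<in> X \<and> j \<in> X \<and> i < j}"

lemma finite_pairs [simp]: "finite X \<Longrightarrow> finite (pairs X)"
  by (rule finite_subset[of _ "X \<times> X"]) (auto simp: pairs_def)

lemma prod_pairs_insert: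
  fixes f :: "nat \<Rightarrow> nat \<Rightarrow> 'a::comm_monoid_mult"
  assumes "finite X" "x \<notin> X"
  shows "(\<Prod>(i, j)\<in>pairs (insert x X). f i j) =
         (\<Prod>(i, j)\<in>pairs X. f i j) * (\<Prod>y\<in>X. f (min x y) (max x y))"
proof -
  let ?h = "\<lambda>y. (min x y, max x y)"
  have eq: "pairs (insert x X) = pairs X \<union> ?h ` X"
  proof (intro set_eqI iffI)
    fix p assume "p \<in> pairs (insert x X)"
    then obtain i j where p: "p = (i, j)" "i \<in> insert x X" "j \<in> insert x X" "i < j"
      by (auto simp: pairs_def)
    show "p \<in> pairs X \<union> ?h ` X"
    proof (cases "i = x \<or> j = x")
      case True
      then have "p = ?h (if i = x then j else i)" "(if i = x then j else i) \<in> X"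
        using p by (auto simp: min_def max_def)
      then show ?thesis by blast
    next
      case False
      then show ?thesis using p by (auto simp: pairs_def)
    qed
  next
    fix p assume "p \<in> pairs X \<union> ?h ` X"
    then show "p \<in> pairs (insert x X)"
    proof (elim UnE imageE)
      fix y assume "p = ?h y" "y \<in> X"
      moreover from this have "x \<noteq> y" using assms(2) by auto
      ultimately show ?thesis by (cases "x < y") (auto simp: pairs_def)
    qed (auto simp: pairs_def)
  qed
  have inj: "inj_on ?h X"
    by (auto simp: inj_on_def min_def max_def split: if_splits)
  have "pairs X \<inter> ?h ` X = {}"
    using assms(2) by (auto simp: pairs_def min_def max_def split: if_splits)
  then show ?thesis
    using assms(1) inj by (simp add: eq prod.union_disjoint prod.reindex o_def)
qed

lemma prod_pairs_insert_sym:
  fixes f :: "nat \<Rightarrow> nat \<Rightarrow> 'a::comm_monoid_mult"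
  assumes "finite X" "x \<notin> X" "\<And>i j. f i j = f j i"
  shows "(\<Prod>(i, j)\<in>pairs (insert x X). f i j) = (\<Prod>(i, j)\<in>pairs X. f i j) * (\<Prod>y\<in>X. f x y)"
  using assms by (auto simp: prod_pairs_insert min_def max_def intro!: arg_cong2[of _ _ _ _ "(*)"] prod.cong)

section \<open>An identity for sums over all splittings of an index set\<close>

text \<open>The sign that is left when the signs \<open>(-1)\<^sup>j\<close> with \<open>j \<in> J\<close> are combined with the orientations of
  the differences \<open>a\<^sub>j - a\<^sub>i\<close> in \<open>cross_prod\<close>. Unlike the product of the \<open>(-1)\<^sup>j\<close>, it depends only on the
  size of \<open>J\<close>, which makes the identity symmetric in the variables.\<close>
definition choose_sign :: "nat \<Rightarrow> real" where
  "choose_sign k = (-1) ^ (k choose 2)"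

lemma choose_sign_0 [simp]: "choose_sign 0 = 1"
  by (simp add: choose_sign_def numeral_2_eq_2)

lemma choose_sign_Suc: "choose_sign (Suc k) = (-1) ^ k * choose_sign k"
  by (simp add: choose_sign_def numeral_2_eq_2 power_add)

definition ratio_prod :: "(nat \<Rightarrow> real) \<Rightarrow> nat set \<Rightarrow> real \<Rightarrow> real" where
  "ratio_prod b Y x = (\<Prod>k\<in>Y. (x - b k) / (x + b k))"

definition cross_prod :: "(nat \<Rightarrow> real) \<Rightarrow> nat set \<Rightarrow> nat set \<Rightarrow> real" where
  "cross_prod a I J = (\<Prod>j\<in>J. \<Prod>i\<in>I. (a j + a i) / (a j - a i))"

definition split_term :: "(nat \<Rightarrow> real) \<Rightarrow> (nat \<Rightarrow> real) \<Rightarrow> nat set \<Rightarrow> nat set \<Rightarrow> nat set \<Rightarrow> real" where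
  "split_term a b Y X J =
     choose_sign (card J) * (\<Prod>j\<in>J. ratio_prod b Y (a j)) * cross_prod a (X - J) J"

text \<open>The closed form of the sum of \<open>split_term\<close> over all \<open>J \<subseteq> X\<close> in the case \<open>|X| = |Y|\<close>.\<close>
definition split_value :: "(nat \<Rightarrow> real) \<Rightarrow> (nat \<Rightarrow> real) \<Rightarrow> nat set \<Rightarrow> nat set \<Rightarrow> real" where
  "split_value a b Y X =
     2 ^ card X * (\<Prod>i\<in>X. a i) * (\<Prod>(i, j)\<in>pairs X. a i + a j) * (\<Prod>(i, j)\<in>pairs Y. b i + b j)
     / (\<Prod>i\<in>X. \<Prod>k\<in>Y. a i + b k)"

lemma sum_Pow_insert:
  fixes f :: "'a set \<Rightarrow> 'b::comm_monoid_add"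
  assumes "finite X" "x \<notin> X"
  shows "(\<Sum>J\<in>Pow (insert x X). f J) = (\<Sum>J\<in>Pow X. f J + f (insert x J))"
proof -
  have "inj_on (insert x) (Pow X)" using assms(2) by (auto simp: inj_on_def)
  moreover have "Pow X \<inter> insert x ` Pow X = {}" using assms(2) by auto
  ultimately show ?thesis
    using assms(1) by (simp add: Pow_insert sum.union_disjoint sum.reindex sum.distrib o_def)
qed

lemma prod_diff_swap:
  fixes f :: "'a \<Rightarrow> real"
  shows "(\<Prod>x\<in>A. c - f x) = (-1) ^ card A * (\<Prod>x\<in>A. f x - c)"
  using prod_uminus[of "\<lambda>x. f x - c" A] by simp

lemma cross_prod_insert_left:
  assumes "finite X" "x \<notin> X" "J \<subseteq> X"
  shows "cross_prod a (insert x X - J) J = cross_prod a (X - J) J * (\<Prod>j\<in>J. (a j + a x) / (a j - a x))"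
proof -
  have "insert x X - J = insert x (X - J)" "x \<notin> X - J" "finite (X - J)" using assms by auto
  then show ?thesis by (simp add: cross_prod_def prod.distrib[symmetric] mult.commute)
qed

lemma cross_prod_insert_right:
  assumes "finite X" "x \<notin> X" "J \<subseteq> X"
  shows "cross_prod a (insert x X - insert x J) (insert x J) =
    cross_prod a (X - J) J * (\<Prod>i\<in>X - J. (a x + a i) / (a x - a i))"
proof -
  have *: "insert x X - insert x J = X - J" "x \<notin> J" "finite J"
    using assms finite_subset by auto
  show ?thesis unfolding * cross_prod_def using * by (simp add: mult.commute)
qed

text \<open>Adding a new variable to either part of a splitting produces the same sign \<open>(-1)\<^bsup>|J|\<^esup>\<close>: in
  \<open>split_term_notin\<close> it comes from turning the factors \<open>a\<^sub>j - a\<^sub>x\<close> around, and in \<open>split_term_in\<close> from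
  \<open>choose_sign\<close>. The two contributions can therefore be added.\<close>
lemma split_term_notin:
  assumes "finite X" "x \<notin> X" "J \<subseteq> X"
  shows "split_term a b Y (insert x X) J =
    (-1) ^ card J * split_term a b Y X J * (\<Prod>j\<in>J. (a x + a j) / (a x - a j))"
proof -
  have "(\<Prod>j\<in>J. (a j + a x) / (a j - a x)) = (\<Prod>j\<in>J. - ((a x + a j) / (a x - a j)))"
    by (intro prod.cong refl) (metis add.commute minus_diff_eq minus_divide_right)
  also have "\<dots> = (-1) ^ card J * (\<Prod>j\<in>J. (a x + a j) / (a x - a j))"
    by (rule prod_uminus)
  finally show ?thesis by (simp add: split_term_def cross_prod_insert_left[OF assms])
qed

lemma split_term_in:
  assumes "finite X" "x \<notin> X" "J \<subseteq> X"
  shows "split_term a b Y (insert x X) (insert x J) =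
    (-1) ^ card J * split_term a b Y X J * ratio_prod b Y (a x) * (\<Prod>i\<in>X - J. (a x + a i) / (a x - a i))"
proof -
  have "x \<notin> J" "finite J" using assms finite_subset by auto
  then show ?thesis
    unfolding split_term_def cross_prod_insert_right[OF assms] by (simp add: choose_sign_Suc)
qed

context
  fixes a b :: "nat \<Rightarrow> real" and X Y :: "nat set"
  assumes finX: "finite X" and finY: "finite Y"
begin

text \<open>The part of the cleared numerator that comes from the splittings with the new variable \<open>t\<close>
  outside \<open>J\<close>. The other splittings contribute \<open>- half_num (- t)\<close>.\<close>
definition half_num :: "real \<Rightarrow> real" where
  "half_num t = (\<Sum>J\<in>Pow X. (-1) ^ card J * split_term a b Y X J *
      ((\<Prod>j\<in>J. t + a j) * (\<Prod>i\<in>X - J. t - a i) * (\<Prod>k\<in>Y. t + b k)))"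

lemma prod_split:
  assumes "J \<subseteq> X"
  shows "(\<Prod>i\<in>X. f i) = (\<Prod>j\<in>J. f j) * (\<Prod>i\<in>X - J. f i :: real)"
  using prod.subset_diff[OF assms finX] by (metis mult.commute)

text \<open>Both summands for a given \<open>J \<subseteq> X\<close> are multiplied by the common denominator. In the second one
  the numerator \<open>\<Prod>\<^bsub>J\<^esub> (t - a\<^sub>j) \<Prod>\<^bsub>X - J\<^esub> (t + a\<^sub>i) \<Prod>\<^bsub>Y\<^esub> (t - b\<^sub>k)\<close> has \<open>|X| + |Y|\<close> factors, an odd number,
  so that it is minus the first numerator at \<open>-t\<close>.\<close>
lemma half_num_odd_part:
  assumes "x \<notin> X" "card Y = Suc (card X)"
    and ne: "\<And>i. i \<in> X \<Longrightarrow> a x \<noteq> a i" "\<And>k. k \<in> Y \<Longrightarrow> a x + b k \<noteq> 0"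
  shows "half_num (a x) - half_num (- a x) =
    (\<Sum>J\<in>Pow (insert x X). split_term a b Y (insert x X) J) * (\<Prod>i\<in>X. a x - a i) * (\<Prod>k\<in>Y. a x + b k)"
proof -
  let ?D = "(\<Prod>i\<in>X. a x - a i) * (\<Prod>k\<in>Y. a x + b k)"
  have "(split_term a b Y (insert x X) J + split_term a b Y (insert x X) (insert x J)) * ?D =
    (-1) ^ card J * split_term a b Y X J *
      ((\<Prod>j\<in>J. a x + a j) * (\<Prod>i\<in>X - J. a x - a i) * (\<Prod>k\<in>Y. a x + b k)) -
    (-1) ^ card J * split_term a b Y X J *
      ((\<Prod>j\<in>J. - a x + a j) * (\<Prod>i\<in>X - J. - a x - a i) * (\<Prod>k\<in>Y. - a x + b k))"
    if J: "J \<subseteq> X" for J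
  proof -
    have fJ: "finite J" using J finX finite_subset by auto
    have "(\<Prod>j\<in>J. (a x + a j) / (a x - a j)) * (\<Prod>j\<in>J. a x - a j) = (\<Prod>j\<in>J. a x + a j)"
      unfolding prod.distrib[symmetric] using ne J by (intro prod.cong) auto
    then have 1: "(\<Prod>j\<in>J. (a x + a j) / (a x - a j)) * ?D =
      (\<Prod>j\<in>J. a x + a j) * (\<Prod>i\<in>X - J. a x - a i) * (\<Prod>k\<in>Y. a x + b k)"
      by (simp add: prod_split[OF J] mult.assoc[symmetric])
    have 2: "(\<Prod>i\<in>X - J. (a x + a i) / (a x - a i)) * (\<Prod>i\<in>X - J. a x - a i) = (\<Prod>i\<in>X - J. a x + a i)"
      unfolding prod.distrib[symmetric] using ne by (intro prod.cong) auto
    have 3: "ratio_prod b Y (a x) * (\<Prod>k\<in>Y. a x + b k) = (\<Prod>k\<in>Y. a x - b k)"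
      unfolding ratio_prod_def prod.distrib[symmetric] using ne by (intro prod.cong) auto
    have "card X = card J + card (X - J)"
      using J finX by (metis card_Diff_subset card_mono fJ le_add_diff_inverse)
    then have sg: "(-1) ^ card J * (-1) ^ card (X - J) * (-1) ^ card Y = (-1::real)"
      unfolding power_add[symmetric] using assms(2) by (simp del: mult_minus1 add: power_add)
         (simp add: power_add[symmetric] mult_2[symmetric])
    have "(\<Prod>j\<in>J. - a x + a j) = (-1) ^ card J * (\<Prod>j\<in>J. a x - a j)"
      using prod_diff_swap[of "a x" a J] by (simp add: mult.assoc[symmetric] power_add[symmetric])
    moreover have "(\<Prod>i\<in>X - J. - a x - a i) = (-1) ^ card (X - J) * (\<Prod>i\<in>X - J. a x + a i)"
      using prod_uminus[of "\<lambda>i. a x + a i"] by simp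
    moreover have "(\<Prod>k\<in>Y. - a x + b k) = (-1) ^ card Y * (\<Prod>k\<in>Y. a x - b k)"
      using prod_uminus[of "\<lambda>k. a x - b k"] by simp
    ultimately have 4: "(\<Prod>j\<in>J. - a x + a j) * (\<Prod>i\<in>X - J. - a x - a i) * (\<Prod>k\<in>Y. - a x + b k)
      = ((-1) ^ card J * (-1) ^ card (X - J) * (-1) ^ card Y) *
        ((\<Prod>j\<in>J. a x - a j) * (\<Prod>i\<in>X - J. a x + a i) * (\<Prod>k\<in>Y. a x - b k))"
      by (simp only: mult_ac)
    have 5: "ratio_prod b Y (a x) * (\<Prod>i\<in>X - J. (a x + a i) / (a x - a i)) * ?D =
       (\<Prod>j\<in>J. a x - a j) * (\<Prod>i\<in>X - J. a x + a i) * (\<Prod>k\<in>Y. a x - b k)"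
      unfolding 2[symmetric] 3[symmetric] prod_split[OF J] by (simp only: mult_ac)
    show ?thesis
      unfolding split_term_notin[OF finX assms(1) J] split_term_in[OF finX assms(1) J] 4 sg 5[symmetric] 1[symmetric]
      by (simp add: algebra_simps)
  qed
  then have "(\<Sum>J\<in>Pow (insert x X). split_term a b Y (insert x X) J) * ?D = half_num (a x) - half_num (- a x)"
    unfolding sum_Pow_insert[OF finX assms(1)] sum_distrib_right half_num_def sum_subtractf[symmetric]
    by (intro sum.cong) auto
  then show ?thesis by (simp add: mult.assoc)
qed

text \<open>The factors of \<open>b\<^sub>k\<close> in \<open>ratio_prod b Y (a\<^sub>j)\<close> turn each \<open>b\<^sub>k + a\<^sub>j\<close> with \<open>j \<in> J\<close> into
  \<open>-(b\<^sub>k - a\<^sub>j)\<close>. After that the product of all \<open>b\<^sub>k - a\<^sub>i\<close> can be taken out of the sum, and the sum for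
  \<open>Y - {k}\<close> remains.\<close>
lemma half_num_at_b:
  assumes "k \<in> Y" "\<And>i. i \<in> X \<Longrightarrow> a i + b k \<noteq> 0"
  shows "half_num (b k) = 2 * b k * (\<Prod>i\<in>X. b k - a i) * (\<Prod>l\<in>Y - {k}. b k + b l) *
     (\<Sum>J\<in>Pow X. split_term a b (Y - {k}) X J)"
    and "half_num (- b k) = 0"
proof -
  show "half_num (- b k) = 0"
    unfolding half_num_def using assms(1) finY by (intro sum.neutral) (auto intro!: prod_zero)
  have Y: "(\<Prod>l\<in>Y. f l) = f k * (\<Prod>l\<in>Y - {k}. f l)" for f :: "nat \<Rightarrow> real"
    using prod.remove[OF finY assms(1)] .
  have "(-1) ^ card J * split_term a b Y X J *
      ((\<Prod>j\<in>J. b k + a j) * (\<Prod>i\<in>X - J. b k - a i) * (\<Prod>k'\<in>Y. b k + b k')) =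
    2 * b k * (\<Prod>i\<in>X. b k - a i) * (\<Prod>l\<in>Y - {k}. b k + b l) * split_term a b (Y - {k}) X J"
    if J: "J \<subseteq> X" for J
  proof -
    have "(\<Prod>j\<in>J. ratio_prod b Y (a j)) * (\<Prod>j\<in>J. b k + a j) =
       (\<Prod>j\<in>J. (- (b k - a j)) * ratio_prod b (Y - {k}) (a j))"
      unfolding prod.distrib[symmetric]
    proof (intro prod.cong refl)
      fix j assume "j \<in> J"
      then have "a j + b k \<noteq> 0" using assms(2) J by auto
      then show "ratio_prod b Y (a j) * (b k + a j) = - (b k - a j) * ratio_prod b (Y - {k}) (a j)"
        unfolding ratio_prod_def Y by (simp add: field_simps)
    qed
    also have "\<dots> = (-1) ^ card J * (\<Prod>j\<in>J. b k - a j) * (\<Prod>j\<in>J. ratio_prod b (Y - {k}) (a j))"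
      by (subst prod.distrib, subst prod_uminus) simp
    finally have 1: "(\<Prod>j\<in>J. ratio_prod b Y (a j)) * (\<Prod>j\<in>J. b k + a j) = \<dots>" .
    have 2: "(-1) ^ card J * ((-1) ^ card J * z) = (z::real)" for z
      by (simp add: mult.assoc[symmetric] power_add[symmetric])
    have "(-1) ^ card J * split_term a b Y X J *
      ((\<Prod>j\<in>J. b k + a j) * (\<Prod>i\<in>X - J. b k - a i) * (\<Prod>k'\<in>Y. b k + b k'))
      = (-1) ^ card J * choose_sign (card J) * cross_prod a (X - J) J *
       ((\<Prod>j\<in>J. ratio_prod b Y (a j)) * (\<Prod>j\<in>J. b k + a j)) * (\<Prod>i\<in>X - J. b k - a i) * (\<Prod>k'\<in>Y. b k + b k')"
      unfolding split_term_def by (simp only: mult_ac)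
    also have "\<dots> = (-1) ^ card J * ((-1) ^ card J * (choose_sign (card J) * cross_prod a (X - J) J *
        ((\<Prod>j\<in>J. b k - a j) * (\<Prod>j\<in>J. ratio_prod b (Y - {k}) (a j))) * (\<Prod>i\<in>X - J. b k - a i) * (\<Prod>k'\<in>Y. b k + b k')))"
      unfolding 1 by (simp only: mult_ac)
    also have "\<dots> = 2 * b k * (\<Prod>i\<in>X. b k - a i) * (\<Prod>l\<in>Y - {k}. b k + b l) * split_term a b (Y - {k}) X J"
      unfolding 2 split_term_def prod_split[OF J] Y by simp
    finally show ?thesis .
  qed
  then show "half_num (b k) = 2 * b k * (\<Prod>i\<in>X. b k - a i) * (\<Prod>l\<in>Y - {k}. b k + b l) *
     (\<Sum>J\<in>Pow X. split_term a b (Y - {k}) X J)"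
    unfolding half_num_def sum_distrib_left by (intro sum.cong) auto
qed

text \<open>At \<open>t = a\<^sub>k\<close> only the summands with \<open>k \<in> J\<close> survive, and at \<open>t = -a\<^sub>k\<close> only those with
  \<open>k \<notin> J\<close>. Moving \<open>k\<close> into \<open>J\<close> matches the two kinds. Matched summands have the same
  factors up to sign, and the signs agree because \<open>|X| + |Y|\<close> is odd.\<close>
lemma half_num_even_at_a:
  assumes k: "k \<in> X" and card: "card Y = Suc (card X)"
    and ne: "\<And>i. i \<in> X \<Longrightarrow> i \<noteq> k \<Longrightarrow> a i \<noteq> a k" "\<And>l. l \<in> Y \<Longrightarrow> a k + b l \<noteq> 0"
  shows "half_num (- a k) = half_num (a k)"
proof -
  define X' where "X' = X - {k}"
  define F where "F t J = (-1) ^ card J * split_term a b Y X J *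
      ((\<Prod>j\<in>J. t + a j) * (\<Prod>i\<in>X - J. t - a i) * (\<Prod>l\<in>Y. t + b l))" for t J
  have X: "X = insert k X'" "k \<notin> X'" and finX': "finite X'"
    using k finX by (auto simp: X'_def)
  have card': "card Y = Suc (Suc (card X'))" using card X finX' by simp
  have vanish: "F (a k) J = 0" "F (- a k) (insert k J) = 0" if "J \<subseteq> X'" for J
  proof -
    have "k \<in> X - J" using that X by auto
    then have "(\<Prod>i\<in>X - J. a k - a i) = 0" using finX by (intro prod_zero) auto
    then show "F (a k) J = 0" by (simp add: F_def)
    have "finite J" using that finX' finite_subset by auto
    then have "(\<Prod>j\<in>insert k J. - a k + a j) = 0" by (intro prod_zero) auto
    then show "F (- a k) (insert k J) = 0" by (simp add: F_def)
  qed
  have match: "F (- a k) J = F (a k) (insert k J)" if J: "J \<subseteq> X'" for J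
  proof -
    have fJ: "finite J" and kJ: "k \<notin> J" using J finX' X finite_subset by auto
    define I where "I = X' - J"
    have fI: "finite I" and kI: "k \<notin> I" using finX' X by (auto simp: I_def)
    have XJ: "X - J = insert k I" "X - insert k J = I" using X kJ J by (auto simp: I_def)
    have nej: "a k - a j \<noteq> 0" if "j \<in> X'" for j
  proof -
    have "j \<in> X" "j \<noteq> k" using that X by auto
    then show ?thesis using ne(1)[of j] by simp
  qed
    have nei: "a i - a k \<noteq> 0" if "i \<in> X'" for i using nej[OF that] by simp
    have "card X' = card J + card I"
      using J finX' unfolding I_def by (metis card_Diff_subset card_mono fJ le_add_diff_inverse)
    then have sg: "(-1) ^ card I * (-1) ^ card Y = ((-1) ^ card J :: real)"
      using card' by (simp add: power_add)
    have ratio_prod: "ratio_prod b Y (a k) * (\<Prod>l\<in>Y. a k + b l) = (\<Prod>l\<in>Y. a k - b l)"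
      unfolding ratio_prod_def prod.distrib[symmetric] using ne by (intro prod.cong) auto
    \<comment> \<open>Minus the common value of the two summands.\<close>
    define V where "V = split_term a b Y X' J * 2 * a k *
      (\<Prod>j\<in>J. a k + a j) * (\<Prod>i\<in>I. a k + a i) * (\<Prod>l\<in>Y. a k - b l)"
    have "F (a k) (insert k J) = (-1) ^ Suc (card J) *
       ((-1) ^ card J * split_term a b Y X' J * ratio_prod b Y (a k) * (\<Prod>i\<in>I. (a k + a i) / (a k - a i))) *
       ((a k + a k) * (\<Prod>j\<in>J. a k + a j) * (\<Prod>i\<in>I. a k - a i) * (\<Prod>l\<in>Y. a k + b l))"
      using split_term_in[OF finX' X(2) J, of a b Y] fJ kJ
      unfolding F_def XJ X(1)[symmetric] I_def[symmetric] by simp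
    also have "\<dots> = - ((-1) ^ card J * (-1) ^ card J) * split_term a b Y X' J * 2 * a k *
       (\<Prod>j\<in>J. a k + a j) * ((\<Prod>i\<in>I. (a k + a i) / (a k - a i)) * (\<Prod>i\<in>I. a k - a i)) *
       (ratio_prod b Y (a k) * (\<Prod>l\<in>Y. a k + b l))"
      by simp
    also have "(\<Prod>i\<in>I. (a k + a i) / (a k - a i)) * (\<Prod>i\<in>I. a k - a i) = (\<Prod>i\<in>I. a k + a i)"
      unfolding prod.distrib[symmetric] using nej by (intro prod.cong) (auto simp: I_def)
    finally have 1: "F (a k) (insert k J) = - V"
      unfolding ratio_prod V_def by (simp add: power_add[symmetric])
    have "F (- a k) J = (-1) ^ card J *
       ((-1) ^ card J * split_term a b Y X' J * (\<Prod>j\<in>J. (a k + a j) / (a k - a j))) *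
       ((\<Prod>j\<in>J. - a k + a j) * ((- a k - a k) * (\<Prod>i\<in>I. - a k - a i)) * (\<Prod>l\<in>Y. - a k + b l))"
      using split_term_notin[OF finX' X(2) J, of a b Y] fI kI
      unfolding F_def XJ X(1)[symmetric] I_def[symmetric] by simp
    also have "(\<Prod>i\<in>I. - a k - a i) = (-1) ^ card I * (\<Prod>i\<in>I. a k + a i)"
      using prod_uminus[of "\<lambda>i. a k + a i"] by simp
    also have "(\<Prod>l\<in>Y. - a k + b l) = (-1) ^ card Y * (\<Prod>l\<in>Y. a k - b l)"
      using prod_uminus[of "\<lambda>l. a k - b l"] by simp
    also have "(\<Prod>j\<in>J. - a k + a j) = (-1) ^ card J * (\<Prod>j\<in>J. a k - a j)"
      using prod_uminus[of "\<lambda>j. a k - a j"] by simp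
    also have "(-1) ^ card J *
       ((-1) ^ card J * split_term a b Y X' J * (\<Prod>j\<in>J. (a k + a j) / (a k - a j))) *
       ((-1) ^ card J * (\<Prod>j\<in>J. a k - a j) * ((- a k - a k) * ((-1) ^ card I * (\<Prod>i\<in>I. a k + a i))) *
         ((-1) ^ card Y * (\<Prod>l\<in>Y. a k - b l)))
       = - ((-1) ^ card J * (-1) ^ card J) * ((-1) ^ card J * ((-1) ^ card I * (-1) ^ card Y)) *
        split_term a b Y X' J * 2 * a k *
        ((\<Prod>j\<in>J. (a k + a j) / (a k - a j)) * (\<Prod>j\<in>J. a k - a j)) * (\<Prod>i\<in>I. a k + a i) * (\<Prod>l\<in>Y. a k - b l)"
      by simp
    also have "(\<Prod>j\<in>J. (a k + a j) / (a k - a j)) * (\<Prod>j\<in>J. a k - a j) = (\<Prod>j\<in>J. a k + a j)"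
      unfolding prod.distrib[symmetric] using nej J by (intro prod.cong) auto
    finally have "F (- a k) J = - V"
      unfolding sg V_def by (simp add: power_add[symmetric])
    with 1 show ?thesis by simp
  qed
  have "half_num t = (\<Sum>J\<in>Pow X'. F t J + F t (insert k J))" for t
    unfolding half_num_def F_def[symmetric] using sum_Pow_insert[OF finX' X(2)] X(1) by simp
  then show ?thesis using vanish match by simp
qed

lemma half_num_poly:
  "\<exists>w. degree w \<le> card X + card Y \<and> (\<forall>t. poly w t = half_num t)"
proof -
  define w where "w = (\<Sum>J\<in>Pow X. smult ((-1) ^ card J * split_term a b Y X J)
      ((\<Prod>j\<in>J. [:a j, 1:]) * (\<Prod>i\<in>X - J. [:- a i, 1:]) * (\<Prod>k\<in>Y. [:b k, 1:])))"
  have lin: "degree (\<Prod>i\<in>S. [:c i, 1::real:]) \<le> card S" for c :: "nat \<Rightarrow> real" and S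
    using degree_prod_eq_sum_degree[of S "\<lambda>i. [:c i, 1:]"] by simp
  have "degree w \<le> card X + card Y"
    unfolding w_def
  proof (rule degree_sum_le)
    fix J assume "J \<in> Pow X"
    then have J: "J \<subseteq> X" by simp
    have "card X = card J + card (X - J)"
      using J finX by (metis card_Diff_subset card_mono finite_subset le_add_diff_inverse)
    then show "degree (smult ((-1) ^ card J * split_term a b Y X J)
      ((\<Prod>j\<in>J. [:a j, 1:]) * (\<Prod>i\<in>X - J. [:- a i, 1:]) * (\<Prod>k\<in>Y. [:b k, 1:]))) \<le> card X + card Y"
      by (intro order.trans[OF degree_smult_le] order.trans[OF degree_mult_le])
        (use lin in \<open>auto intro!: add_mono order.trans[OF degree_mult_le]\<close>)
  qed (use finX in auto)
  moreover have "poly w t = half_num t" for t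
    by (simp add: w_def half_num_def poly_sum poly_prod add.commute)
  ultimately show ?thesis by blast
qed

end
text \<open>Positivity of all variables makes the interpolation points \<open>0\<close>, \<open>b\<^sub>k\<close> and \<open>-a\<^sub>i\<close> distinct, even if
  some \<open>a\<^sub>i\<close> equals some \<open>b\<^sub>k\<close>.\<close>
lemma split_sum_pos:
  assumes "finite X" "finite Y" "card Y = card X"
    "inj_on a X" "\<And>i. i \<in> X \<Longrightarrow> a i > 0" "inj_on b Y" "\<And>k. k \<in> Y \<Longrightarrow> b k > 0"
  shows "(\<Sum>J\<in>Pow X. split_term a b Y X J) = split_value a b Y X"
  using assms
proof (induction X arbitrary: Y rule: finite_induct)
  case empty
  then show ?case
    by (simp add: split_term_def split_value_def cross_prod_def pairs_def)
next
  case (insert x X)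
  note finX = insert.hyps(1) and x = insert.hyps(2)
  have finY: "finite Y" and card: "card Y = Suc (card X)" using insert by auto
  have apos: "a i > 0" if "i \<in> insert x X" for i using insert.prems(4) that by auto
  have bpos: "b k > 0" if "k \<in> Y" for k using insert.prems(6) that by auto
  have ainj: "inj_on a (insert x X)" and binj: "inj_on b Y" using insert.prems by auto
  have sum_ne: "a i + b k \<noteq> 0" if "i \<in> insert x X" "k \<in> Y" for i k
    using apos[OF that(1)] bpos[OF that(2)] by simp
  \<comment> \<open>The induction hypothesis for \<open>Y - {k}\<close> leads to this constant whatever \<open>k\<close> is, since the factors
    of the removed \<open>b\<^sub>k\<close> are restored by those that \<open>half_num_at_b\<close> takes out of the sum.\<close>
  define \<kappa> where "\<kappa> = 2 ^ card X * (\<Prod>i\<in>X. a i) * (\<Prod>(i, j)\<in>pairs X. a i + a j) *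
     (\<Prod>(i, j)\<in>pairs Y. b i + b j) / (\<Prod>i\<in>X. \<Prod>k\<in>Y. a i + b k)"
  obtain w where w: "degree w \<le> card X + card Y" "\<And>t. poly w t = half_num a b X Y t"
    using half_num_poly[OF finX finY, of a b] by blast
  define p where "p = w - pcompose w [:0, -1:]"
  define q where "q = [:0, 2 * \<kappa>:] * (\<Prod>i\<in>X. [:- a i, 1:] * [:a i, 1:])"
  have poly_p: "poly p t = half_num a b X Y t - half_num a b X Y (- t)" for t
    by (simp add: p_def w poly_pcompose)
  have poly_q: "poly q t = 2 * t * \<kappa> * ((\<Prod>i\<in>X. t - a i) * (\<Prod>i\<in>X. t + a i))" for t
    by (simp add: q_def poly_prod prod.distrib[symmetric] algebra_simps)
  have "degree p \<le> card X + card Y"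
    using w(1) by (auto simp: p_def degree_pcompose intro!: degree_diff_le)
  moreover have "degree q \<le> card X + card Y"
  proof -
    have "degree (\<Prod>i\<in>X. [:- a i, 1:] * [:a i, 1:]) \<le> (\<Sum>i\<in>X. 2)"
      by (rule order.trans[OF degree_prod_sum_le[OF finX]], rule sum_mono) simp
    moreover have "degree [:0, 2 * \<kappa>:] \<le> 1" by simp
    ultimately have "degree q \<le> 1 + (\<Sum>i\<in>X. 2)"
      unfolding q_def by (intro order.trans[OF degree_mult_le] add_mono)
    then show ?thesis using card by simp
  qed
  moreover define P where "P = insert 0 ((\<lambda>k. b k) ` Y \<union> (\<lambda>i. - a i) ` X)"
  have "card P = Suc (card X + card Y)"
  proof -
    have "b ` Y \<inter> (\<lambda>i. - a i) ` X = {}"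
      using apos bpos by (force simp: disjoint_iff)
    moreover have "0 \<notin> b ` Y \<union> (\<lambda>i. - a i) ` X"
      using apos bpos by force
    moreover have "inj_on (\<lambda>i. - a i) X" using ainj by (auto simp: inj_on_def)
    ultimately show ?thesis
      unfolding P_def using finX finY binj
      by (simp add: card_Un_disjoint card_image)
  qed
  moreover have "poly p t = poly q t" if "t \<in> P" for t
  proof -
    from that consider "t = 0" | k where "k \<in> Y" "t = b k" | i where "i \<in> X" "t = - a i"
      by (auto simp: P_def)
    then show ?thesis
    proof cases
      case 1
      then show ?thesis by (simp add: poly_p poly_q)
    next
      case (2 k)
      have Y: "Y = insert k (Y - {k})" using 2 by auto
      have "(\<Sum>J\<in>Pow X. split_term a b (Y - {k}) X J) = split_value a b (Y - {k}) X"
        using ainj binj apos bpos finY card 2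
        by (intro insert.IH) (auto simp: inj_on_def)
      moreover have "split_value a b (Y - {k}) X * (\<Prod>l\<in>Y - {k}. b k + b l) = \<kappa> * (\<Prod>i\<in>X. b k + a i)"
      proof -
        have "(\<Prod>(i, j)\<in>pairs Y. b i + b j) =
          (\<Prod>(i, j)\<in>pairs (Y - {k}). b i + b j) * (\<Prod>l\<in>Y - {k}. b k + b l)"
          by (subst Y, subst prod_pairs_insert_sym) (use finY in \<open>auto simp: add.commute\<close>)
        moreover have "(\<Prod>i\<in>X. \<Prod>k\<in>Y. a i + b k) = (\<Prod>i\<in>X. b k + a i) * (\<Prod>i\<in>X. \<Prod>k\<in>Y - {k}. a i + b k)"
          unfolding prod.distrib[symmetric] using prod.remove[OF finY 2(1)]
          by (intro prod.cong refl) (simp add: add.commute)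
        moreover have "(\<Prod>i\<in>X. b k + a i) \<noteq> 0"
          using sum_ne[of _ k] 2 finX by (auto simp: add.commute)
        ultimately show ?thesis
          by (simp add: split_value_def \<kappa>_def)
      qed
      ultimately show ?thesis
        using half_num_at_b[OF finX finY 2(1), of a] sum_ne 2
        by (simp add: poly_p poly_q mult_ac)
    next
      case (3 i)
      have "half_num a b X Y (- a i) = half_num a b X Y (a i)"
        using 3 ainj x card sum_ne by (intro half_num_even_at_a[OF finX finY]) (auto simp: inj_on_def)
      moreover have "(\<Prod>i'\<in>X. - a i + a i') = 0" using 3 finX by (intro prod_zero) auto
      ultimately show ?thesis using 3 by (simp add: poly_p poly_q)
    qed
  qed
  ultimately have "p = q"
    by (intro poly_eqI_degree[of P]) auto
  then have eq: "half_num a b X Y (a x) - half_num a b X Y (- a x) =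
    2 * a x * \<kappa> * ((\<Prod>i\<in>X. a x - a i) * (\<Prod>i\<in>X. a x + a i))"
    using poly_p[of "a x"] poly_q[of "a x"] by simp
  have nz: "(\<Prod>i\<in>X. a x - a i) \<noteq> 0" "(\<Prod>k\<in>Y. a x + b k) \<noteq> 0"
    using ainj x finX finY sum_ne by (auto simp: inj_on_def)
  have "half_num a b X Y (a x) - half_num a b X Y (- a x) =
    (\<Sum>J\<in>Pow (insert x X). split_term a b Y (insert x X) J) * (\<Prod>i\<in>X. a x - a i) * (\<Prod>k\<in>Y. a x + b k)"
    using ainj x sum_ne by (intro half_num_odd_part[OF finX finY x card]) (auto simp: inj_on_def)
  with eq nz have "(\<Sum>J\<in>Pow (insert x X). split_term a b Y (insert x X) J) =
      2 * a x * \<kappa> * (\<Prod>i\<in>X. a x + a i) / (\<Prod>k\<in>Y. a x + b k)"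
    by (simp add: field_simps)
  also have "\<dots> = split_value a b Y (insert x X)"
  proof -
    have "(\<Prod>(i, j)\<in>pairs (insert x X). a i + a j) = (\<Prod>(i, j)\<in>pairs X. a i + a j) * (\<Prod>i\<in>X. a x + a i)"
      using prod_pairs_insert_sym[OF finX x, of "\<lambda>i j. a i + a j"] by (simp add: add.commute)
    then show ?thesis using finX x by (simp add: split_value_def \<kappa>_def mult_ac)
  qed
  finally show ?case .
qed

text \<open>Replacing every \<open>b\<^sub>k\<close> by \<open>b\<^sub>k + t\<close> and letting \<open>t\<close> tend to \<open>0\<close> from the right reduces the claim to
  positive \<open>b\<^sub>k\<close>.\<close>
lemma split_sum:
  assumes "finite X" "finite Y" "card Y = card X"
    "inj_on a X" "\<And>i. i \<in> X \<Longrightarrow> a i > 0" "inj_on b Y" "\<And>k. k \<in> Y \<Longrightarrow> b k \<ge> 0"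
  shows "(\<Sum>J\<in>Pow X. split_term a b Y X J) = split_value a b Y X"
proof -
  let ?S = "\<lambda>t. \<Sum>J\<in>Pow X. split_term a (\<lambda>k. b k + t) Y X J"
  let ?V = "\<lambda>t. split_value a (\<lambda>k. b k + t) Y X"
  have ne: "a i + b k \<noteq> 0" if "i \<in> X" "k \<in> Y" for i k
    using assms(5)[OF that(1)] assms(7)[OF that(2)] by simp
  have "(?S \<longlongrightarrow> ?S 0) (at_right 0)"
    unfolding split_term_def ratio_prod_def
    by (intro tendsto_intros) (use ne in auto)
  moreover have "(?V \<longlongrightarrow> ?V 0) (at_right 0)"
    unfolding split_value_def case_prod_unfold
    by (intro tendsto_intros) (use ne assms(1,2) in auto)
  moreover have "\<forall>\<^sub>F t in at_right 0. ?S t = ?V t"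
    using assms by (auto simp: eventually_at_right_field inj_on_def intro!: exI[of _ 1] split_sum_pos add_nonneg_pos)
  ultimately have "(?S \<longlongrightarrow> ?V 0) (at_right 0)"
    using tendsto_cong[of ?S ?V] by simp
  with \<open>(?S \<longlongrightarrow> ?S 0) (at_right 0)\<close> show ?thesis
    using tendsto_unique[OF trivial_limit_at_right_real] by fastforce
qed

section \<open>The product of ratios of differences and sums\<close>

definition ratio :: "real \<Rightarrow> real \<Rightarrow> real" where
  "ratio x y = (x - y) / (x + y)"

lemma ratio_swap: "ratio y x = - ratio x y"
  unfolding ratio_def by (metis add.commute minus_diff_eq minus_divide_left)

lemma ratio_self [simp]: "ratio x x = 0"
  by (simp add: ratio_def)

definition schur_prod :: "(nat \<Rightarrow> real) \<Rightarrow> nat set \<Rightarrow> real" where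
  "schur_prod a X = (\<Prod>(i, j)\<in>pairs X. ratio (a i) (a j))"

lemma schur_prod_empty [simp]: "schur_prod a {} = 1"
  by (simp add: schur_prod_def pairs_def)

lemma schur_prod_insert_last:
  assumes "finite X" "\<And>i. i \<in> X \<Longrightarrow> i < n"
  shows "schur_prod a (insert n X) = schur_prod a X * (\<Prod>i\<in>X. ratio (a i) (a n))"
proof -
  have "n \<notin> X" using assms(2) by blast
  then show ?thesis
    using assms unfolding schur_prod_def
    by (subst prod_pairs_insert) (auto simp: max_def min_def dest!: assms(2) intro!: prod.cong)
qed

text \<open>Each ratio between \<open>X - J\<close> and \<open>J\<close> is missing on the left, and \<open>cross_prod\<close> removes it on the
  right up to the sign of the orientation. In the induction a last index \<open>n\<close> in \<open>J\<close> has \<open>|X - J|\<close>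
  wrongly oriented pairs, and \<open>choose_sign\<close> supplies \<open>(-1)\<close> to the number of the other elements of \<open>J\<close>;
  together this is \<open>(-1)\<^sup>n\<close>.\<close>
lemma schur_prod_split:
  assumes "inj_on a {..<n}" "\<And>i j. i < n \<Longrightarrow> j < n \<Longrightarrow> i \<noteq> j \<Longrightarrow> a i + a j \<noteq> 0" "J \<subseteq> {..<n}"
  shows "schur_prod a ({..<n} - J) * schur_prod a J * (\<Prod>j\<in>J. (-1) ^ j) =
    schur_prod a {..<n} * choose_sign (card J) * cross_prod a ({..<n} - J) J"
  using assms
proof (induction n arbitrary: J)
  case 0
  then show ?case by (simp add: cross_prod_def)
next
  case (Suc n)
  define J' where "J' = J - {n}"
  define I where "I = {..<n} - J'"
  have J': "J' \<subseteq> {..<n}" using Suc.prems(3) by (auto simp: J'_def)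
  have fin: "finite J'" "finite I" using J' finite_subset by (auto simp: I_def)
  have lt: "\<And>i. i \<in> J' \<Longrightarrow> i < n" "\<And>i. i \<in> I \<Longrightarrow> i < n" using J' by (auto simp: I_def)
  have nin: "n \<notin> I" "n \<notin> J'" using lt by auto
  have ne: "a n - a i \<noteq> 0" "a i - a n \<noteq> 0" "a i + a n \<noteq> 0" if "i < n" for i
  proof -
    have "a i \<noteq> a n" using inj_onD[OF Suc.prems(1), of i n] that by auto
    then show "a n - a i \<noteq> 0" "a i - a n \<noteq> 0" by auto
    show "a i + a n \<noteq> 0" using Suc.prems(2)[of i n] that by auto
  qed
  have all: "schur_prod a {..<Suc n} = schur_prod a {..<n} * (\<Prod>i\<in>I. ratio (a i) (a n)) * (\<Prod>i\<in>J'. ratio (a i) (a n))"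
    using schur_prod_insert_last[of "{..<n}" n a] prod.subset_diff[OF J', of "\<lambda>i. ratio (a i) (a n)"]
    by (simp add: lessThan_Suc I_def)
  have IH: "schur_prod a I * schur_prod a J' * (\<Prod>j\<in>J'. (-1) ^ j) =
    schur_prod a {..<n} * choose_sign (card J') * cross_prod a I J'"
    unfolding I_def using Suc.prems by (intro Suc.IH J') (auto simp: inj_on_def)
  show ?case
  proof (cases "n \<in> J")
    case True
    then have J: "J = insert n J'" by (auto simp: J'_def)
    have I: "{..<Suc n} - J = I" using J by (auto simp: I_def)
    have "(\<Prod>i\<in>I. ratio (a i) (a n)) * (\<Prod>i\<in>I. (a n + a i) / (a n - a i)) = (\<Prod>i\<in>I. - 1)"
      unfolding prod.distrib[symmetric]
    proof (intro prod.cong refl)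
      fix i assume "i \<in> I"
      then have "ratio (a n) (a i) * ((a n + a i) / (a n - a i)) = 1"
        using ne[OF lt(2)] by (simp add: ratio_def add.commute)
      then show "ratio (a i) (a n) * ((a n + a i) / (a n - a i)) = - 1"
        unfolding ratio_swap[of "a i" "a n"] mult_minus_left by (rule arg_cong)
    qed
    also have "\<dots> = (-1) ^ card I" by simp
    finally have 1: "(\<Prod>i\<in>I. ratio (a i) (a n)) * (\<Prod>i\<in>I. (a n + a i) / (a n - a i)) = (-1) ^ card I" .
    have "n = card J' + card I"
      using J' fin unfolding I_def
      by (metis card_Diff_subset card_lessThan card_mono finite_lessThan le_add_diff_inverse)
    then have sg: "(-1) ^ n = (-1) ^ card J' * ((-1) ^ card I :: real)" by (metis power_add)
    have "schur_prod a ({..<Suc n} - J) * schur_prod a J * (\<Prod>j\<in>J. (-1) ^ j) =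
      (schur_prod a I * schur_prod a J' * (\<Prod>j\<in>J'. (-1) ^ j)) * (-1) ^ n * (\<Prod>i\<in>J'. ratio (a i) (a n))"
      unfolding I unfolding J using fin nin lt by (simp add: schur_prod_insert_last)
    also have "\<dots> = schur_prod a {..<Suc n} * choose_sign (card J) * cross_prod a ({..<Suc n} - J) J"
      unfolding IH sg I all 1[symmetric] using fin nin
      by (simp add: J choose_sign_Suc cross_prod_def)
    finally show ?thesis .
  next
    case False
    then have J: "J = J'" by (auto simp: J'_def)
    have I: "{..<Suc n} - J = insert n I" using False by (auto simp: I_def J'_def)
    have "(\<Prod>j\<in>J'. ratio (a j) (a n)) * (\<Prod>j\<in>J'. (a j + a n) / (a j - a n)) = (\<Prod>j\<in>J'. 1)"
      unfolding prod.distrib[symmetric] using ne lt by (intro prod.cong refl) (simp add: ratio_def)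
    then have 1: "(\<Prod>j\<in>J'. ratio (a j) (a n)) * (\<Prod>j\<in>J'. (a j + a n) / (a j - a n)) = 1" by simp
    have 2: "cross_prod a (insert n I) J' = cross_prod a I J' * (\<Prod>j\<in>J'. (a j + a n) / (a j - a n))"
      using fin nin by (simp add: cross_prod_def prod.distrib[symmetric] mult.commute)
    have "schur_prod a ({..<Suc n} - J) * schur_prod a J * (\<Prod>j\<in>J. (-1) ^ j) =
      (schur_prod a I * schur_prod a J' * (\<Prod>j\<in>J'. (-1) ^ j)) * (\<Prod>i\<in>I. ratio (a i) (a n))"
      unfolding I unfolding J using fin lt by (simp add: schur_prod_insert_last)
    also have "\<dots> = schur_prod a {..<n} * choose_sign (card J') * cross_prod a I J' * (\<Prod>i\<in>I. ratio (a i) (a n)) *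
       ((\<Prod>j\<in>J'. ratio (a j) (a n)) * (\<Prod>j\<in>J'. (a j + a n) / (a j - a n)))"
      unfolding IH 1 by simp
    also have "\<dots> = schur_prod a {..<Suc n} * choose_sign (card J) * cross_prod a ({..<Suc n} - J) J"
      unfolding I all unfolding J 2 by simp
    finally show ?thesis .
  qed
qed

text \<open>The closed form of \<open>g_bar_seq\<close>. It makes sense for every sequence: at a repetition it is \<open>0\<close>,
  also for a repeated \<open>0\<close>, where the ratio is \<open>0 / 0 = 0\<close>.\<close>
definition g_prod :: "nat list \<Rightarrow> real" where
  "g_prod K = (\<Prod>i<length K. 1 / fact (K ! i)) * schur_prod (\<lambda>i. real (K ! i)) {..<length K}"

lemma g_prod_Nil [simp]: "g_prod [] = 1"
  by (simp add: g_prod_def)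

lemma g_prod_snoc:
  "g_prod (K @ [x]) = g_prod K * (1 / fact x) * (\<Prod>i<length K. ratio (real (K ! i)) (real x))"
proof -
  have "schur_prod (\<lambda>i. real ((K @ [x]) ! i)) {..<length K} = schur_prod (\<lambda>i. real (K ! i)) {..<length K}"
    unfolding schur_prod_def by (intro prod.cong refl) (auto simp: pairs_def nth_append)
  moreover have "schur_prod (\<lambda>i. real ((K @ [x]) ! i)) {..<Suc (length K)} =
      schur_prod (\<lambda>i. real ((K @ [x]) ! i)) {..<length K} * (\<Prod>i<length K. ratio (real (K ! i)) (real x))"
    unfolding lessThan_Suc by (subst schur_prod_insert_last) (auto simp: nth_append)
  ultimately show ?thesis
    by (simp add: g_prod_def) (simp add: nth_append)
qed

lemma g_prod_not_distinct: "\<not> distinct K \<Longrightarrow> g_prod K = 0"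
proof -
  assume "\<not> distinct K"
  then obtain i j where "i < length K" "j < length K" "i \<noteq> j" "K ! i = K ! j"
    by (auto simp: distinct_conv_nth)
  then have "(min i j, max i j) \<in> pairs {..<length K}" "K ! min i j = K ! max i j"
    by (auto simp: pairs_def min_def max_def)
  then have "schur_prod (\<lambda>i. real (K ! i)) {..<length K} = 0"
    unfolding schur_prod_def by (intro prod_zero) force+
  then show ?thesis by (simp add: g_prod_def)
qed

section \<open>Antisymmetry under permutations of a sequence\<close>

text \<open>Exchanging \<open>k\<close> and \<open>k + 1\<close> reverses the order of no pair except \<open>(k, k + 1)\<close> itself.\<close>
lemma prod_pairs_permute_adjacent:
  fixes f :: "nat \<Rightarrow> nat \<Rightarrow> real"
  assumes anti: "\<And>i j. f i j = - f j i" and k: "Suc k < n"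
  shows "(\<Prod>(i, j)\<in>pairs {..<n}. f (transpose k (Suc k) i) (transpose k (Suc k) j)) = - (\<Prod>(i, j)\<in>pairs {..<n}. f i j)"
proof -
  let ?t = "transpose k (Suc k)"
  let ?S = "pairs {..<n} - {(k, Suc k)}"
  have split: "(\<Prod>(i, j)\<in>pairs {..<n}. g i j) = g k (Suc k) * (\<Prod>(i, j)\<in>?S. g i j)" for g :: "nat \<Rightarrow> nat \<Rightarrow> real"
  proof -
    have "(k, Suc k) \<in> pairs {..<n}" using k by (auto simp: pairs_def)
    then show ?thesis by (subst prod.remove) auto
  qed
  have lt: "?t i < n" if "i < n" for i using that k by (auto simp: transpose_def)
  have mono: "?t i < ?t j" if "i < j" "(i, j) \<noteq> (k, Suc k)" for i j
    using that by (auto simp: transpose_def)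
  have not_k: "(?t i, ?t j) \<noteq> (k, Suc k)" if "i < j" for i j
    using that by (auto simp: transpose_def split: if_splits)
  have closed: "(?t i, ?t j) \<in> ?S" if "(i, j) \<in> ?S" for i j
    using that lt mono[of i j] not_k[of i j] by (simp add: pairs_def)
  have "(\<Prod>(i, j)\<in>?S. f (?t i) (?t j)) = (\<Prod>(i, j)\<in>?S. f i j)"
    by (rule prod.reindex_bij_witness[of _ "\<lambda>(i, j). (?t i, ?t j)" "\<lambda>(i, j). (?t i, ?t j)"])
      (use closed in force)+
  then show ?thesis
    unfolding split by (simp add: anti[of "Suc k" k])
qed

text \<open>A transposition of distance \<open>d + 1\<close> is one of distance \<open>d\<close> conjugated by an adjacent one, so it
  costs two more changes of sign.\<close>
lemma prod_pairs_permute_transpose: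
  fixes f :: "nat \<Rightarrow> nat \<Rightarrow> real"
  assumes anti: "\<And>i j. f i j = - f j i" and ab: "a + Suc d < n"
  shows "(\<Prod>(i, j)\<in>pairs {..<n}. f (transpose a (a + Suc d) i) (transpose a (a + Suc d) j)) =
    - (\<Prod>(i, j)\<in>pairs {..<n}. f i j)"
  using assms
proof (induction d arbitrary: f)
  case 0
  show ?case using prod_pairs_permute_adjacent[OF "0.prems"(1), of a n] "0.prems"(2) by simp
next
  case (Suc d)
  define b where "b = a + Suc d"
  let ?s = "transpose b (Suc b)" and ?t = "transpose a b"
  have b: "a + Suc (Suc d) = Suc b" "Suc b < n" "a < b" using Suc.prems(2) by (auto simp: b_def)
  have conj: "transpose a (Suc b) i = ?s (?t (?s i))" for i
    using b(3) by (auto simp: transpose_def)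
  have "(\<Prod>(i, j)\<in>pairs {..<n}. f (?s (?t (?s i))) (?s (?t (?s j)))) =
      - (\<Prod>(i, j)\<in>pairs {..<n}. f (?s (?t i)) (?s (?t j)))"
    using b(2) by (intro prod_pairs_permute_adjacent[of "\<lambda>i j. f (?s (?t i)) (?s (?t j))"] Suc.prems(1))
  also have "(\<Prod>(i, j)\<in>pairs {..<n}. f (?s (?t i)) (?s (?t j))) = - (\<Prod>(i, j)\<in>pairs {..<n}. f (?s i) (?s j))"
    using b(2) unfolding b_def by (intro Suc.IH[of "\<lambda>i j. f (?s i) (?s j)", unfolded b_def] Suc.prems(1)) auto
  also have "(\<Prod>(i, j)\<in>pairs {..<n}. f (?s i) (?s j)) = - (\<Prod>(i, j)\<in>pairs {..<n}. f i j)"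
    using b(2) by (intro prod_pairs_permute_adjacent Suc.prems(1))
  finally show ?case unfolding b(1) conj by simp
qed

lemma prod_pairs_permute:
  fixes f :: "nat \<Rightarrow> nat \<Rightarrow> real"
  assumes "w permutes {..<n}" and anti: "\<And>i j. f i j = - f j i"
  shows "(\<Prod>(i, j)\<in>pairs {..<n}. f (w i) (w j)) = of_int (sign w) * (\<Prod>(i, j)\<in>pairs {..<n}. f i j)"
  using finite_lessThan assms
proof (induction w arbitrary: f rule: permutes_rev_induct)
  case id
  show ?case by simp
next
  case (swap a b p)
  have *: "(\<Prod>(i, j)\<in>pairs {..<n}. g (transpose a b i) (transpose a b j)) = - (\<Prod>(i, j)\<in>pairs {..<n}. g i j)"
    if "\<And>i j. g i j = - g j i" for g :: "nat \<Rightarrow> nat \<Rightarrow> real"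
  proof (cases "a < b")
    case True
    then obtain d where "b = a + Suc d" using less_imp_Suc_add by auto
    then show ?thesis using prod_pairs_permute_transpose[OF that, of a d n] swap.hyps by auto
  next
    case False
    then have "b < a" using swap.hyps by simp
    then obtain d where "a = b + Suc d" using less_imp_Suc_add by auto
    then show ?thesis
      using prod_pairs_permute_transpose[OF that, of b d n] swap.hyps by (auto simp: transpose_commute)
  qed
  have "sign (p \<circ> transpose a b) = - sign p"
    using swap.hyps permutes_imp_permutation[OF finite_lessThan swap.hyps(4)]
    by (simp add: sign_compose permutation_swap_id sign_swap_id)
  then have sg: "of_int (sign (p \<circ> transpose a b)) = - (of_int (sign p) :: real)" by simp
  show ?case
    unfolding sg unfolding o_apply *[of "\<lambda>i j. f (p i) (p j)", OF swap.prems] swap.IH[of f, OF swap.prems] by simp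
qed

lemma g_prod_permute_list:
  assumes "w permutes {..<length K}"
  shows "g_prod (map (\<lambda>i. K ! w i) [0..<length K]) = of_int (sign w) * g_prod K"
proof -
  let ?L = "map (\<lambda>i. K ! w i) [0..<length K]"
  have "(\<Prod>i<length K. 1 / fact (K ! w i)) = (\<Prod>i<length K. 1 / fact (K ! i) :: real)"
    using prod.permute[OF assms, of "\<lambda>i. 1 / fact (K ! i) :: real"] by (simp add: o_def)
  moreover have "schur_prod (\<lambda>i. real (?L ! i)) {..<length K} =
      (\<Prod>(i, j)\<in>pairs {..<length K}. ratio (real (K ! w i)) (real (K ! w j)))"
    unfolding schur_prod_def by (intro prod.cong refl) (auto simp: pairs_def)
  moreover have "\<dots> = of_int (sign w) * schur_prod (\<lambda>i. real (K ! i)) {..<length K}"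
    unfolding schur_prod_def
    by (rule prod_pairs_permute[OF assms, of "\<lambda>i j. ratio (real (K ! i)) (real (K ! j))"]) (rule ratio_swap)
  ultimately show ?thesis by (simp add: g_prod_def)
qed

section \<open>Hook-length products\<close>

lemma pairs_lessThan: "pairs {..<n} = (SIGMA i:{..<n}. {i<..<n})"
  by (auto simp: pairs_def)

lemma prod_pairs_lessThan: "(\<Prod>(i, j)\<in>pairs {..<n}. f i j) = (\<Prod>i<n. \<Prod>j\<in>{i<..<n}. f i j)"
  by (simp add: pairs_lessThan prod.Sigma)

text \<open>The hooks and the differences are distinct numbers in \<open>{1..r i - i}\<close>, and there are
  \<open>(r i - n) + (n - i)\<close> of them, so their product is the factorial. A hook at column \<open>j\<close> cannot equal the
  difference for row \<open>k\<close>, because \<open>c j + 1 + r k\<close> exceeds \<open>j + k\<close> if the square \<open>(k, j)\<close> is in the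
  diagram and falls short of it otherwise. The hypothesis \<open>gal\<close> is symmetric in the row lengths \<open>r\<close> and
  the column lengths \<open>c\<close>, so that the lemma applies to columns as well.\<close>
lemma hook_row_beyond_square:
  fixes r c :: "nat \<Rightarrow> nat"
  assumes gal: "\<And>i j. 1 \<le> i \<Longrightarrow> 1 \<le> j \<Longrightarrow> j \<le> r i \<longleftrightarrow> i \<le> c j"
    and diag: "\<And>i. 1 \<le> i \<Longrightarrow> i \<le> r i \<longleftrightarrow> i \<le> n"
    and i: "1 \<le> i" "i \<le> n"
  shows "(\<Prod>j\<in>{n<..r i}. r i + c j + 1 - i - j) * (\<Prod>k\<in>{i<..n}. (r i - i) - (r k - k)) = fact (r i - i)"
proof -
  define H where "H j = r i + c j + 1 - i - j" for j
  define D where "D k = (r i - i) - (r k - k)" for k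
  have r_anti: "r l \<le> r k" if "1 \<le> k" "k \<le> l" for k l
    using gal[of l "r l"] gal[of k "r l"] that by (cases "r l = 0") auto
  have c_anti: "c l \<le> c j" if "1 \<le> j" "j \<le> l" for j l
    using gal[of "c l" l] gal[of "c l" j] that by (cases "c l = 0") auto
  have i_r: "i \<le> r i" using diag i by simp
  have n_r: "n \<le> r i" using diag[of n] r_anti[of i n] i by simp
  have c_ge: "i \<le> c j" if "j \<in> {n<..r i}" for j
    using gal[of i j] that i by auto
  have c_lt: "c j < j" if "n < j" for j
    using gal[of j j] diag[of j] that i by auto
  have k_r: "k \<le> r k" if "k \<in> {i<..n}" for k
    using diag[of k] that i by auto
  have H_less: "H l < H j" if "j \<in> {n<..r i}" "l \<in> {n<..r i}" "j < l" for j l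
    using c_anti[of j l] c_ge[of l] that i unfolding H_def by auto
  have D_less: "D k < D l" if "k \<in> {i<..n}" "l \<in> {i<..n}" "k < l" for k l
    using r_anti[of k l] r_anti[of i k] k_r[of k] k_r[of l] that i unfolding D_def by auto
  have "inj_on H {n<..r i}"
    by (rule linorder_inj_onI') (metis H_less less_irrefl)
  moreover have "inj_on D {i<..n}"
    by (rule linorder_inj_onI') (metis D_less less_irrefl)
  ultimately have card: "card (H ` {n<..r i}) = r i - n" "card (D ` {i<..n}) = n - i"
    and prods: "prod id (H ` {n<..r i}) = prod H {n<..r i}" "prod id (D ` {i<..n}) = prod D {i<..n}"
    by (simp_all add: card_image prod.reindex)
  have "H j \<noteq> D k" if "j \<in> {n<..r i}" "k \<in> {i<..n}" for j k
  proof (cases "j \<le> r k")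
    case True
    then have "k \<le> c j" using gal[of k j] that i by auto
    then show ?thesis using True k_r[OF that(2)] r_anti[of i k] that i i_r unfolding H_def D_def by auto
  next
    case False
    then have "c j < k" using gal[of k j] that i by auto
    then show ?thesis
      using False k_r[OF that(2)] r_anti[of i k] c_ge[OF that(1)] that i i_r unfolding H_def D_def by auto
  qed
  then have disj: "H ` {n<..r i} \<inter> D ` {i<..n} = {}" by auto
  have "H ` {n<..r i} \<union> D ` {i<..n} \<subseteq> {1..r i - i}"
  proof -
    have "H j \<in> {1..r i - i}" if "j \<in> {n<..r i}" for j
      using c_ge[OF that] c_lt[of j] that i i_r unfolding H_def by auto
    moreover have "D k \<in> {1..r i - i}" if "k \<in> {i<..n}" for k
      using k_r[OF that] r_anti[of i k] that i i_r unfolding D_def by auto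
    ultimately show ?thesis by auto
  qed
  moreover have "card (H ` {n<..r i} \<union> D ` {i<..n}) = card {1..r i - i}"
    using disj card n_r i by (subst card_Un_disjoint) auto
  ultimately have "H ` {n<..r i} \<union> D ` {i<..n} = {1..r i - i}"
    by (intro card_subset_eq) auto
  then have "prod id {1..r i - i} = prod H {n<..r i} * prod D {i<..n}"
    using disj prods by (metis finite_greaterThanAtMost finite_imageI prod.union_disjoint)
  then show ?thesis by (simp add: fact_prod H_def D_def)
qed

lemma part_antimono:
  assumes "is_partition mu" "1 \<le> k" "k \<le> l"
  shows "part mu l \<le> part mu k"
  using assms by (cases "k = l") (auto simp: is_partition_def part_def sorted_wrt_iff_nth_less)

lemma part_conj_galois:
  assumes mu: "is_partition mu" and ij: "1 \<le> i" "1 \<le> j"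
  shows "j \<le> part mu i \<longleftrightarrow> i \<le> conj_part mu j"
proof -
  let ?S = "{i. 1 \<le> i \<and> i \<le> length mu \<and> j \<le> part mu i}"
  have fin: "finite ?S" by simp
  have len: "i \<le> length mu" if "j \<le> part mu i" for i
    using that ij by (auto simp: part_def split: if_splits)
  show ?thesis
  proof
    assume "j \<le> part mu i"
    then have "{1..i} \<subseteq> ?S" using part_antimono[OF mu] len ij by (auto intro: order.trans)
    from card_mono[OF fin this] show "i \<le> conj_part mu j" by (simp add: conj_part_def)
  next
    assume *: "i \<le> conj_part mu j"
    show "j \<le> part mu i"
    proof (rule ccontr)
      assume "\<not> j \<le> part mu i"
      then have "?S \<subseteq> {1..<i}" using part_antimono[OF mu, of i] ij by (auto simp: not_le) (meson leD leI order.trans)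
      from card_mono[OF _ this] have "conj_part mu j < i" using ij by (simp add: conj_part_def)
      with * show False by simp
    qed
  qed
qed

lemma part_ge_diag_iff:
  assumes mu: "is_partition mu" and i: "1 \<le> i"
  shows "i \<le> part mu i \<longleftrightarrow> i \<le> diag_len mu"
proof -
  let ?S = "{i. (i, i) \<in> diagram mu}"
  have S: "i \<in> ?S \<longleftrightarrow> 1 \<le> i \<and> i \<le> part mu i" for i
    by (auto simp: diagram_def part_def)
  have fin: "finite ?S" by (rule finite_subset[of _ "{..length mu}"]) (auto simp: diagram_def)
  show ?thesis
  proof
    assume "i \<le> part mu i"
    then have "{1..i} \<subseteq> ?S" using part_antimono[OF mu] S i by (force intro: order.trans)
    from card_mono[OF fin this] show "i \<le> diag_len mu" by (simp add: diag_len_def)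
  next
    assume *: "i \<le> diag_len mu"
    show "i \<le> part mu i"
    proof (rule ccontr)
      assume n: "\<not> i \<le> part mu i"
      have "?S \<subseteq> {1..<i}"
      proof
        fix l assume "l \<in> ?S"
        then have "1 \<le> l" "l \<le> part mu l" using S by auto
        then show "l \<in> {1..<i}" using part_antimono[OF mu, of i l] n i by (cases "i \<le> l") auto
      qed
      from card_mono[OF _ this] have "diag_len mu < i" using i by (simp add: diag_len_def)
      with * show False by simp
    qed
  qed
qed

lemma conj_part_ge_diag_iff:
  assumes "is_partition mu" "1 \<le> i"
  shows "i \<le> conj_part mu i \<longleftrightarrow> i \<le> diag_len mu"
  using part_conj_galois[OF assms(1,2,2)] part_ge_diag_iff[OF assms] by simp

lemma conj_part_antimono:
  assumes "is_partition mu" "1 \<le> k" "k \<le> l"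
  shows "conj_part mu l \<le> conj_part mu k"
  using part_conj_galois[OF assms(1), of "conj_part mu l" l] part_conj_galois[OF assms(1), of "conj_part mu l" k] assms
  by (cases "conj_part mu l = 0") auto

lemma length_frob [simp]:
  "length (frob_alpha mu) = diag_len mu" "length (frob_beta mu) = diag_len mu"
  by (simp_all add: frob_alpha_def frob_beta_def)

lemma nth_frob:
  assumes "i < diag_len mu"
  shows "frob_alpha mu ! i = part mu (Suc i) - Suc i" "frob_beta mu ! i = conj_part mu (Suc i) - Suc i"
  using assms by (simp_all add: frob_alpha_def frob_beta_def del: upt_Suc)

lemma hook_square:
  assumes "is_partition mu" "i < diag_len mu" "j < diag_len mu"
  shows "hook mu (Suc i, Suc j) = frob_alpha mu ! i + frob_beta mu ! j + 1"
  using part_ge_diag_iff[OF assms(1), of "Suc i"] conj_part_ge_diag_iff[OF assms(1), of "Suc j"] assms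
  by (simp add: hook_def nth_frob)

lemma prod_Suc_interval: "(\<Prod>k\<in>{Suc i<..n}. f k) = (\<Prod>k\<in>{i<..<n}. f (Suc k))"
  by (rule prod.reindex_bij_witness[of _ Suc "\<lambda>k. k - 1"]) auto

lemma prod_Sigma_rows:
  assumes "\<And>i. finite (S i)"
  shows "(\<Prod>x\<in>(SIGMA i:{1..n}. S i). f x) = (\<Prod>i<n. \<Prod>j\<in>S (Suc i). f (Suc i, j))"
  using prod.Sigma[of "{1..n}" S "\<lambda>i j. f (i, j)"] assms by (simp add: prod.atLeast1_atMost_eq)

lemma inverse_hooks_from_product:
  fixes al :: "nat \<Rightarrow> nat"
  assumes "(\<Prod>j\<in>S. h j) * (\<Prod>k\<in>T. al i - al k) = fact (al i)" "finite T"
    "\<And>k. k \<in> T \<Longrightarrow> al k \<le> al i"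
  shows "(\<Prod>j\<in>S. 1 / real (h j)) = (\<Prod>k\<in>T. real (al i) - real (al k)) / fact (al i)"
proof -
  have "real ((\<Prod>j\<in>S. h j) * (\<Prod>k\<in>T. al i - al k)) = fact (al i)"
    unfolding assms(1) by simp
  then have *: "(\<Prod>j\<in>S. real (h j)) * (\<Prod>k\<in>T. real (al i) - real (al k)) = fact (al i)"
    using assms(3) by (simp add: of_nat_diff)
  then have "(\<Prod>j\<in>S. real (h j)) \<noteq> 0" by (metis fact_nonzero mult_zero_left)
  then show ?thesis using * by (simp add: prod_dividef field_simps)
qed

lemma frob_strict_decreasing:
  assumes mu: "is_partition mu" and "i < k" "k < diag_len mu"
  shows "frob_alpha mu ! k < frob_alpha mu ! i" "frob_beta mu ! k < frob_beta mu ! i"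
  using assms part_antimono[OF mu, of "Suc i" "Suc k"] conj_part_antimono[OF mu, of "Suc i" "Suc k"]
    part_ge_diag_iff[OF mu, of "Suc k"] conj_part_ge_diag_iff[OF mu, of "Suc k"]
  by (auto simp: nth_frob)

lemma alpha_hooks:
  assumes mu: "is_partition mu" and i: "i < diag_len mu"
  shows "(\<Prod>j\<in>{diag_len mu<..part mu (Suc i)}. 1 / real (hook mu (Suc i, j))) =
    (\<Prod>k\<in>{i<..<diag_len mu}. real (frob_alpha mu ! i) - real (frob_alpha mu ! k)) / fact (frob_alpha mu ! i)"
proof (rule inverse_hooks_from_product)
  show "(\<Prod>j\<in>{diag_len mu<..part mu (Suc i)}. hook mu (Suc i, j)) *
    (\<Prod>k\<in>{i<..<diag_len mu}. frob_alpha mu ! i - frob_alpha mu ! k) = fact (frob_alpha mu ! i)"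
    using hook_row_beyond_square[of "part mu" "conj_part mu" "diag_len mu" "Suc i",
        OF part_conj_galois[OF mu] part_ge_diag_iff[OF mu]] i
    by (simp add: hook_def prod_Suc_interval nth_frob)
qed (use frob_strict_decreasing(1)[OF mu] in \<open>auto intro: less_imp_le\<close>)

lemma beta_hooks:
  assumes mu: "is_partition mu" and j: "j < diag_len mu"
  shows "(\<Prod>i\<in>{diag_len mu<..conj_part mu (Suc j)}. 1 / real (hook mu (i, Suc j))) =
    (\<Prod>k\<in>{j<..<diag_len mu}. real (frob_beta mu ! j) - real (frob_beta mu ! k)) / fact (frob_beta mu ! j)"
proof (rule inverse_hooks_from_product)
  show "(\<Prod>i\<in>{diag_len mu<..conj_part mu (Suc j)}. hook mu (i, Suc j)) *
    (\<Prod>k\<in>{j<..<diag_len mu}. frob_beta mu ! j - frob_beta mu ! k) = fact (frob_beta mu ! j)"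
    using hook_row_beyond_square[of "conj_part mu" "part mu" "diag_len mu" "Suc j",
        OF part_conj_galois[OF mu, symmetric] conj_part_ge_diag_iff[OF mu]] j
    by (simp add: hook_def prod_Suc_interval nth_frob add.commute diff_right_commute)
qed (use frob_strict_decreasing(2)[OF mu] in \<open>auto intro: less_imp_le\<close>)

text \<open>The factor that each of the two Frobenius sequences contributes to \<open>f_bar\<close>.\<close>
definition difference_weight :: "nat list \<Rightarrow> real" where
  "difference_weight K = (\<Prod>(i, j)\<in>pairs {..<length K}. real (K ! i) - real (K ! j)) / (\<Prod>i<length K. fact (K ! i))"

lemma in_diagram_iff: "(i, j) \<in> diagram mu \<longleftrightarrow> 1 \<le> i \<and> 1 \<le> j \<and> j \<le> part mu i"
  by (auto simp: diagram_def part_def)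

lemma part_ge_diag_len:
  assumes "is_partition mu" "1 \<le> i" "i \<le> diag_len mu"
  shows "diag_len mu \<le> part mu i"
  using part_antimono[OF assms] part_ge_diag_iff[OF assms(1), of "diag_len mu"] assms by simp

text \<open>The diagram consists of the \<open>n \<times> n\<close> square, whose hooks are \<open>\<alpha>\<^sub>i + \<beta>\<^sub>j + 1\<close>, and of the remaining
  squares to the right of it and below it.\<close>
lemma f_bar_frobenius:
  assumes mu: "is_partition mu"
  shows "f_bar mu = difference_weight (frob_alpha mu) * difference_weight (frob_beta mu) /
    (\<Prod>i<diag_len mu. \<Prod>j<diag_len mu. real (frob_alpha mu ! i) + real (frob_beta mu ! j) + 1)"
proof -
  define n where "n = diag_len mu"
  let ?h = "\<lambda>x. 1 / real (hook mu x)"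
  let ?R = "SIGMA i:{1..n}. {n<..part mu i}"
  let ?C = "SIGMA j:{1..n}. {n<..conj_part mu j}"
  have small: "j \<le> n" if "n < i" "1 \<le> j" "j \<le> part mu i" for i j
  proof (rule ccontr)
    assume "\<not> j \<le> n"
    then have "conj_part mu j < j" "part mu i < i"
      using conj_part_ge_diag_iff[OF mu, of j] part_ge_diag_iff[OF mu, of i] that by (auto simp: n_def)
    moreover have "i \<le> conj_part mu j" using part_conj_galois[OF mu, of i j] that by auto
    ultimately show False using that by simp
  qed
  have "diagram mu = {1..n} \<times> {1..n} \<union> ?R \<union> prod.swap ` ?C"
  proof (intro set_eqI iffI)
    fix x assume "x \<in> diagram mu"
    then obtain i j where x: "x = (i, j)" "1 \<le> i" "1 \<le> j" "j \<le> part mu i"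
      by (cases x) (auto simp: in_diagram_iff)
    moreover have "i \<le> conj_part mu j" using part_conj_galois[OF mu] x by auto
    ultimately show "x \<in> {1..n} \<times> {1..n} \<union> ?R \<union> prod.swap ` ?C"
      using small[of i j] by (cases "i \<le> n"; cases "j \<le> n") (auto simp: image_iff)
  next
    fix x assume "x \<in> {1..n} \<times> {1..n} \<union> ?R \<union> prod.swap ` ?C"
    then consider i j where "x = (i, j)" "i \<in> {1..n}" "j \<in> {1..n}"
      | i j where "x = (i, j)" "i \<in> {1..n}" "j \<in> {n<..part mu i}"
      | i j where "x = (i, j)" "j \<in> {1..n}" "i \<in> {n<..conj_part mu j}"
      by auto
    then show "x \<in> diagram mu"
    proof cases
      case (1 i j)
      then show ?thesis using part_ge_diag_len[OF mu, of i] by (simp add: in_diagram_iff n_def)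
    next
      case (2 i j)
      then show ?thesis by (simp add: in_diagram_iff)
    next
      case (3 i j)
      then show ?thesis using part_conj_galois[OF mu, of i j] by (simp add: in_diagram_iff)
    qed
  qed
  moreover have "({1..n} \<times> {1..n}) \<inter> ?R = {}" "({1..n} \<times> {1..n} \<union> ?R) \<inter> prod.swap ` ?C = {}" by auto
  ultimately have "f_bar mu = prod ?h ({1..n} \<times> {1..n}) * prod ?h ?R * prod ?h (prod.swap ` ?C)"
    unfolding f_bar_def by (simp add: prod.union_disjoint)
  also have "prod ?h ({1..n} \<times> {1..n}) = (\<Prod>i<n. \<Prod>j<n. ?h (Suc i, Suc j))"
    by (simp add: prod.cartesian_product' prod.atLeast1_atMost_eq)
  also have "\<dots> = 1 / (\<Prod>i<n. \<Prod>j<n. real (frob_alpha mu ! i) + real (frob_beta mu ! j) + 1)"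
    by (simp add: hook_square[OF mu] n_def prod_dividef add_ac)
  also have "prod ?h ?R = (\<Prod>i<n. \<Prod>j\<in>{n<..part mu (Suc i)}. ?h (Suc i, j))"
    by (rule prod_Sigma_rows) simp
  also have "\<dots> = difference_weight (frob_alpha mu)"
    by (simp add: alpha_hooks[OF mu] n_def) (simp add: difference_weight_def prod_pairs_lessThan prod_dividef)
  also have "prod ?h (prod.swap ` ?C) = (\<Prod>j<n. \<Prod>i\<in>{n<..conj_part mu (Suc j)}. ?h (i, Suc j))"
    by (simp add: prod.reindex prod_Sigma_rows del: One_nat_def)
  also have "\<dots> = difference_weight (frob_beta mu)"
    by (simp add: beta_hooks[OF mu] n_def) (simp add: difference_weight_def prod_pairs_lessThan prod_dividef)
  finally show ?thesis by (simp add: n_def)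
qed

text \<open>Row \<open>i\<close> of the shifted diagram begins just behind the diagonal of the double diagram. Up to column
  \<open>n\<close> its hooks are \<open>\<lambda>\<^sub>i + \<lambda>\<^sub>j\<close>, and beyond column \<open>n\<close> they are those of \<open>alpha_hooks\<close>.\<close>
lemma g_bar_eq_g_prod:
  assumes dec: "sorted_wrt (>) lam" and pos: "0 \<notin> set lam"
  shows "g_bar lam = g_prod lam"
proof -
  define mu where "mu = double_partition lam"
  define n where "n = length lam"
  let ?h = "\<lambda>x. 1 / real (hook mu x)"
  have nth_pos: "lam ! i > 0" if "i < n" for i
    using that pos by (metis gr0I n_def nth_mem)
  have "sorted_wrt (>) (map (\<lambda>l. l - 1) lam)"
    using dec nth_pos by (auto simp: sorted_wrt_iff_nth_less n_def diff_less_mono Suc_leI)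
  note fr = of_frobenius_correct[OF dec this, simplified, folded double_partition_def, folded mu_def]
  have mu: "is_partition mu" and dl: "diag_len mu = n" and al: "frob_alpha mu = lam"
    and be: "frob_beta mu = map (\<lambda>l. l - 1) lam"
    using fr unfolding mu_def double_partition_def n_def by simp_all
  have "shifted_diagram lam = (SIGMA i:{1..n}. {i<..part mu i})"
  proof (intro set_eqI iffI)
    fix x assume "x \<in> shifted_diagram lam"
    then obtain i j where x: "x = (i, j)" "1 \<le> i" "j \<le> part mu i" "i < j"
      by (cases x) (auto simp: shifted_diagram_def in_diagram_iff mu_def)
    then show "x \<in> (SIGMA i:{1..n}. {i<..part mu i})"
      using part_ge_diag_iff[OF mu, of i] by (auto simp: dl)
  qed (auto simp: shifted_diagram_def in_diagram_iff mu_def)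
  then have "g_bar lam = (\<Prod>i<n. \<Prod>j\<in>{Suc i<..part mu (Suc i)}. ?h (Suc i, j))"
    unfolding g_bar_def mu_def[symmetric] by (simp add: prod_Sigma_rows del: One_nat_def)
  also have "\<dots> = (\<Prod>i<n. (\<Prod>j\<in>{i<..<n}. ratio (lam ! i) (lam ! j)) / fact (lam ! i))"
  proof (intro prod.cong refl)
    fix i assume "i \<in> {..<n}"
    then have i: "i < n" by simp
    have "n \<le> part mu (Suc i)" using part_ge_diag_len[OF mu, of "Suc i"] i by (simp add: dl)
    then have "{Suc i<..part mu (Suc i)} = {Suc i<..n} \<union> {n<..part mu (Suc i)}" using i by auto
    then have "(\<Prod>j\<in>{Suc i<..part mu (Suc i)}. ?h (Suc i, j)) =
      (\<Prod>j\<in>{Suc i<..n}. ?h (Suc i, j)) * (\<Prod>j\<in>{n<..part mu (Suc i)}. ?h (Suc i, j))"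
      by (simp add: prod.union_disjoint ivl_disj_int)
    also have "(\<Prod>j\<in>{Suc i<..n}. ?h (Suc i, j)) = (\<Prod>j\<in>{i<..<n}. 1 / (real (lam ! i) + real (lam ! j)))"
      unfolding prod_Suc_interval
    proof (intro prod.cong refl)
      fix j assume "j \<in> {i<..<n}"
      then show "?h (Suc i, Suc j) = 1 / (real (lam ! i) + real (lam ! j))"
        using hook_square[OF mu, of i j] i nth_pos[of j] by (simp add: dl al be n_def)
    qed
    also have "(\<Prod>j\<in>{n<..part mu (Suc i)}. ?h (Suc i, j)) =
        (\<Prod>j\<in>{i<..<n}. real (lam ! i) - real (lam ! j)) / fact (lam ! i)"
      using alpha_hooks[OF mu, of i] i by (simp add: dl al)
    finally show "(\<Prod>j\<in>{Suc i<..part mu (Suc i)}. ?h (Suc i, j)) =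
        (\<Prod>j\<in>{i<..<n}. ratio (lam ! i) (lam ! j)) / fact (lam ! i)"
      by (simp add: ratio_def prod_dividef)
  qed
  also have "\<dots> = g_prod lam"
    by (simp add: g_prod_def schur_prod_def prod_pairs_lessThan n_def prod_dividef)
  finally show ?thesis .
qed

lemma g_bar_pos_eq_g_prod:
  assumes "distinct K" "0 \<notin> set K"
  shows "g_bar_pos K = g_prod K"
proof -
  let ?w = "sort_perm K"
  have w: "?w permutes {..<length K}" "sorted_wrt (>) (decr_rearr K)"
    using theI'[OF sort_perm_ex1[OF assms(1)]] unfolding sort_perm_def decr_rearr_def by auto
  have "0 \<notin> set (decr_rearr K)"
  proof
    assume "0 \<in> set (decr_rearr K)"
    then obtain i where i: "i < length K" "K ! ?w i = 0" by (auto simp: decr_rearr_def)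
    then have "?w i < length K" using permutes_in_image[OF w(1), of i] by simp
    then show False using i assms(2) by (metis nth_mem)
  qed
  then have "g_bar_pos K = of_int (sign ?w) * g_prod (decr_rearr K)"
    using w by (simp add: g_bar_pos_def g_bar_eq_g_prod)
  also have "\<dots> = of_int (sign ?w * sign ?w) * g_prod K"
    unfolding decr_rearr_def g_prod_permute_list[OF w(1)] by (simp only: of_int_mult mult.assoc)
  finally show ?thesis unfolding sign_idempotent by simp
qed

text \<open>A final entry \<open>0\<close> has the factors \<open>1 / 0! = 1\<close> and \<open>(k - 0) / (k + 0) = 1\<close>, so dropping it does
  not change the product.\<close>
lemma g_bar_seq_eq_g_prod:
  assumes "distinct K" "0 \<notin> set (butlast K)"
  shows "g_bar_seq K = g_prod K"
proof (cases "0 \<in> set K")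
  case False
  then show ?thesis using assms by (simp add: g_bar_seq_def g_bar_pos_eq_g_prod)
next
  case True
  then have "K = butlast K @ [last K]" by (intro append_butlast_last_id[symmetric]) auto
  moreover from this have "last K = 0"
    using True assms(2) by (metis Un_iff empty_iff empty_set set_ConsD set_append)
  ultimately have K: "K = butlast K @ [0]" by simp
  define L where "L = butlast K"
  have K: "K = L @ [0]" and L: "0 \<notin> set L" "distinct L" using K assms by (auto simp: L_def distinct_butlast)
  have "ratio (real (L ! i)) 0 = 1" if "i < length L" for i
  proof -
    have "L ! i \<noteq> 0" using that L(1) by (metis nth_mem)
    then show ?thesis by (simp add: ratio_def)
  qed
  then have "g_prod K = g_prod L" unfolding K g_prod_snoc by simp
  moreover have "removeAll 0 K = L" using L by (simp add: K)
  ultimately show ?thesis using L by (simp add: g_bar_seq_def g_bar_pos_eq_g_prod)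
qed

section \<open>Interleaved sequences\<close>

lemma splice_snoc:
  "length X = length Y \<Longrightarrow> splice (X @ [x]) (Y @ [y]) = splice X Y @ [x, y]"
  by (induction X Y rule: list_induct2) auto

text \<open>The interleaving of initial segments of two infinite sequences, which allows induction on the
  length from the right end.\<close>
definition interleave_seq :: "(nat \<Rightarrow> nat) \<Rightarrow> (nat \<Rightarrow> nat) \<Rightarrow> nat set \<Rightarrow> nat \<Rightarrow> nat list" where
  "interleave_seq a b I n = interleave_del (map a [0..<n]) (map b [0..<n]) I"

lemma interleave_seq_0 [simp]: "interleave_seq a b I 0 = []"
  by (simp add: interleave_seq_def interleave_del_def)

lemma interleave_seq_Suc:
  "interleave_seq a b I (Suc n) = interleave_seq a b I n @ (if n \<in> I then [b n] else [a n, b n])"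
proof -
  have "n + n = 2 * i \<longleftrightarrow> n = i" "Suc (n + n) \<noteq> 2 * i" for i
    by (auto, presburger)
  then show ?thesis
    by (simp add: interleave_seq_def interleave_del_def splice_snoc nths_append nths_Cons) blast
qed

lemma prod_interleave_seq:
  fixes h :: "nat \<Rightarrow> real"
  shows "(\<Prod>i<length (interleave_seq a b I n). h (interleave_seq a b I n ! i)) =
     (\<Prod>j\<in>{..<n} - I. h (a j)) * (\<Prod>k<n. h (b k))"
proof (induction n)
  case (Suc n)
  have "{..<Suc n} - I = (if n \<in> I then {..<n} - I else insert n ({..<n} - I))"
    by (auto simp: lessThan_Suc)
  moreover have snoc: "(\<Prod>i<length (L @ [x]). h ((L @ [x]) ! i)) = (\<Prod>i<length L. h (L ! i)) * h x" for L x
    by (simp add: nth_append)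
  have snoc2: "(\<Prod>i<length (L @ [x, y]). h ((L @ [x, y]) ! i)) = (\<Prod>i<length L. h (L ! i)) * h x * h y" for L x y
  proof -
    have "L @ [x, y] = (L @ [x]) @ [y]" by simp
    then show ?thesis by (simp only: snoc)
  qed
  ultimately show ?case
    unfolding interleave_seq_Suc using Suc.IH by (simp only: snoc snoc2 split: if_split) simp
qed simp

text \<open>The entry \<open>a\<^sub>j\<close> stands behind \<open>b\<^sub>0, \<dots>, b\<^bsub>j - 1\<^esub>\<close> and before the other \<open>b\<^sub>k\<close>. Writing all these
  ratios as \<open>(a\<^sub>j - b\<^sub>k) / (a\<^sub>j + b\<^sub>k)\<close> costs the sign \<open>(-1)\<^sup>j\<close>.\<close>
lemma g_prod_interleave_seq:
  "g_prod (interleave_seq a b I n) =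
     (\<Prod>j\<in>{..<n} - I. 1 / fact (a j)) * (\<Prod>k<n. 1 / fact (b k)) *
     schur_prod (\<lambda>i. real (a i)) ({..<n} - I) * schur_prod (\<lambda>k. real (b k)) {..<n} *
     ((\<Prod>j\<in>{..<n} - I. (-1) ^ j) * (\<Prod>j\<in>{..<n} - I. ratio_prod (\<lambda>k. real (b k)) {..<n} (real (a j))))"
proof (induction n)
  case (Suc n)
  let ?J = "{..<n} - I" and ?L = "interleave_seq a b I n"
  let ?A = "\<lambda>i. real (a i)" and ?B = "\<lambda>k. real (b k)"
  have b: "schur_prod ?B {..<Suc n} = schur_prod ?B {..<n} * (\<Prod>k<n. ratio (?B k) (?B n))"
    unfolding lessThan_Suc by (rule schur_prod_insert_last) auto
  have ratio_prod_Suc: "ratio_prod ?B {..<Suc n} x = ratio_prod ?B {..<n} x * ratio x (?B n)" for x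
    by (simp add: ratio_prod_def ratio_def)
  show ?case
  proof (cases "n \<in> I")
    case True
    then have J: "{..<Suc n} - I = ?J" by (auto simp: lessThan_Suc)
    have "g_prod (interleave_seq a b I (Suc n)) =
      g_prod ?L * (1 / fact (b n)) * ((\<Prod>j\<in>?J. ratio (?A j) (?B n)) * (\<Prod>k<n. ratio (?B k) (?B n)))"
      using True by (simp add: interleave_seq_Suc g_prod_snoc prod_interleave_seq[of "\<lambda>y. ratio (real y) (?B n)"])
    then show ?thesis
      unfolding J Suc.IH by (simp add: b ratio_prod_Suc prod.distrib)
  next
    case False
    then have J: "{..<Suc n} - I = insert n ?J" by (auto simp: lessThan_Suc)
    have a: "schur_prod ?A (insert n ?J) = schur_prod ?A ?J * (\<Prod>i\<in>?J. ratio (?A i) (?A n))"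
      by (rule schur_prod_insert_last) auto
    have flip: "(\<Prod>k<n. ratio (?B k) (?A n)) = (-1) ^ n * ratio_prod ?B {..<n} (?A n)"
    proof -
      have "(\<Prod>k<n. ratio (?B k) (?A n)) = (\<Prod>k<n. - ratio (?A n) (?B k))"
        by (intro prod.cong refl) (rule ratio_swap)
      then show ?thesis by (simp add: prod_uminus ratio_prod_def ratio_def)
    qed
    have "g_prod (interleave_seq a b I (Suc n)) = g_prod (?L @ [a n]) * (1 / fact (b n)) *
      (\<Prod>i<length (?L @ [a n]). ratio ((?L @ [a n]) ! i) (?B n))"
      using False g_prod_snoc[of "?L @ [a n]" "b n"] by (simp add: interleave_seq_Suc)
    also have "(\<Prod>i<length (?L @ [a n]). ratio ((?L @ [a n]) ! i) (?B n)) =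
       (\<Prod>i<length ?L. ratio (?L ! i) (?B n)) * ratio (?A n) (?B n)"
      by (simp add: nth_append)
    also have "g_prod (?L @ [a n]) = g_prod ?L * (1 / fact (a n)) *
       ((\<Prod>j\<in>?J. ratio (?A j) (?A n)) * ((-1) ^ n * ratio_prod ?B {..<n} (?A n)))"
      by (simp add: g_prod_snoc prod_interleave_seq[of "\<lambda>y. ratio (real y) (?A n)"] flip)
    finally show ?thesis
      unfolding J Suc.IH
      by (simp add: a b ratio_prod_Suc prod.distrib prod_interleave_seq[of "\<lambda>y. ratio (real y) (?B n)"])
  qed
qed (simp add: ratio_prod_def)

lemma g_prod_nths:
  "g_prod (nths (map a [0..<n]) I) =
     (\<Prod>i\<in>I \<inter> {..<n}. 1 / fact (a i)) * schur_prod (\<lambda>i. real (a i)) (I \<inter> {..<n})"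
proof -
  have prod_nths: "(\<Prod>i<length (nths (map a [0..<n]) I). h (nths (map a [0..<n]) I ! i)) = (\<Prod>i\<in>I \<inter> {..<n}. h (a i))"
    for h :: "nat \<Rightarrow> real" and n
  proof (induction n)
    case (Suc n)
    have "I \<inter> {..<Suc n} = (if n \<in> I then insert n (I \<inter> {..<n}) else I \<inter> {..<n})"
      by (auto simp: lessThan_Suc)
    then show ?case using Suc.IH by (simp add: nths_append nth_append mult.commute)
  qed simp
  show ?thesis
  proof (induction n)
    case (Suc n)
    have I: "I \<inter> {..<Suc n} = (if n \<in> I then insert n (I \<inter> {..<n}) else I \<inter> {..<n})"
      by (auto simp: lessThan_Suc)
    have "schur_prod (\<lambda>i. real (a i)) (insert n (I \<inter> {..<n})) =
      schur_prod (\<lambda>i. real (a i)) (I \<inter> {..<n}) * (\<Prod>i\<in>I \<inter> {..<n}. ratio (real (a i)) (real (a n)))"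
      by (rule schur_prod_insert_last) auto
    then show ?case
      using Suc.IH unfolding I
      by (simp add: nths_append g_prod_snoc prod_nths[of "\<lambda>y. ratio (real y) (real (a n))"])
  qed simp
qed

lemma schur_prod_mult_sums:
  assumes "\<And>i j. (i, j) \<in> pairs X \<Longrightarrow> a i + a j \<noteq> 0"
  shows "schur_prod a X * (\<Prod>(i, j)\<in>pairs X. a i + a j) = (\<Prod>(i, j)\<in>pairs X. a i - a j)"
  unfolding schur_prod_def prod.distrib[symmetric]
  by (intro prod.cong refl) (use assms in \<open>auto simp: ratio_def\<close>)

section \<open>The expansion\<close>

text \<open>After the factors common to all summands are taken out, the sum is that of \<open>split_sum\<close>, with \<open>J\<close> the
  complement of \<open>I\<close>. The ratios in the common factors then combine with the products of sums in
  \<open>split_value\<close> to products of differences.\<close>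
lemma sum_g_prod:
  fixes a b :: "nat \<Rightarrow> nat"
  assumes a: "\<And>i j. i < j \<Longrightarrow> j < n \<Longrightarrow> a j < a i" "\<And>i. i < n \<Longrightarrow> 0 < a i"
    and b: "\<And>i j. i < j \<Longrightarrow> j < n \<Longrightarrow> b j < b i"
  shows "(\<Sum>I\<in>Pow {..<n}. g_prod (nths (map a [0..<n]) I) * g_prod (interleave_seq a b I n)) =
     2 ^ n * (\<Prod>i<n. real (a i)) *
     ((\<Prod>(i, j)\<in>pairs {..<n}. real (a i) - real (a j)) / (\<Prod>i<n. fact (a i))) *
     ((\<Prod>(i, j)\<in>pairs {..<n}. real (b i) - real (b j)) / (\<Prod>i<n. fact (b i))) /
     (\<Prod>i<n. \<Prod>k<n. real (a i) + real (b k))"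
proof -
  let ?A = "\<lambda>i. real (a i)" and ?B = "\<lambda>k. real (b k)"
  have injA: "inj_on ?A {..<n}" and injB: "inj_on ?B {..<n}"
    using a(1) b by (auto intro!: linorder_inj_onI' simp: less_imp_neq[symmetric])
  define \<kappa> where "\<kappa> = (\<Prod>i<n. 1 / fact (a i)) * (\<Prod>k<n. 1 / fact (b k)) * schur_prod ?A {..<n} * schur_prod ?B {..<n}"
  have split_J: "g_prod (nths (map a [0..<n]) ({..<n} - J)) * g_prod (interleave_seq a b ({..<n} - J) n) =
    \<kappa> * split_term ?A ?B {..<n} {..<n} J" if J: "J \<subseteq> {..<n}" for J
  proof -
    have sets: "({..<n} - J) \<inter> {..<n} = {..<n} - J" "{..<n} - ({..<n} - J) = J" using J by auto
    have "schur_prod ?A ({..<n} - J) * schur_prod ?A J * (\<Prod>j\<in>J. (-1) ^ j) =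
      schur_prod ?A {..<n} * choose_sign (card J) * cross_prod ?A ({..<n} - J) J"
      using a(2) by (intro schur_prod_split[OF injA _ J]) (auto simp: add_pos_pos less_imp_neq[symmetric])
    moreover have "(\<Prod>i<n. 1 / fact (a i) :: real) = (\<Prod>i\<in>{..<n} - J. 1 / fact (a i)) * (\<Prod>i\<in>J. 1 / fact (a i))"
      by (rule prod.subset_diff[OF J]) simp
    ultimately show ?thesis
      unfolding g_prod_nths g_prod_interleave_seq sets \<kappa>_def split_term_def
      by (simp add: mult_ac)
  qed
  have "g_prod (nths (map a [0..<n]) I) * g_prod (interleave_seq a b I n) =
    \<kappa> * split_term ?A ?B {..<n} {..<n} ({..<n} - I)" if "I \<subseteq> {..<n}" for I
  proof -
    have "{..<n} - ({..<n} - I) = I" using that by auto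
    then show ?thesis using split_J[of "{..<n} - I"] by simp
  qed
  then have "(\<Sum>I\<in>Pow {..<n}. g_prod (nths (map a [0..<n]) I) * g_prod (interleave_seq a b I n)) =
    (\<Sum>J\<in>Pow {..<n}. \<kappa> * split_term ?A ?B {..<n} {..<n} J)"
    by (intro sum.reindex_bij_witness[of _ "\<lambda>J. {..<n} - J" "\<lambda>J. {..<n} - J"]) (auto simp: double_diff)
  also have "\<dots> = \<kappa> * split_value ?A ?B {..<n} {..<n}"
    unfolding sum_distrib_left[symmetric] using a(2) by (subst split_sum) (auto intro!: injA injB)
  also have "\<dots> = 2 ^ n * (\<Prod>i<n. real (a i)) *
     ((\<Prod>(i, j)\<in>pairs {..<n}. real (a i) - real (a j)) / (\<Prod>i<n. fact (a i))) *
     ((\<Prod>(i, j)\<in>pairs {..<n}. real (b i) - real (b j)) / (\<Prod>i<n. fact (b i))) /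
     (\<Prod>i<n. \<Prod>k<n. real (a i) + real (b k))"
  proof -
    have "schur_prod ?A {..<n} * (\<Prod>(i, j)\<in>pairs {..<n}. ?A i + ?A j) = (\<Prod>(i, j)\<in>pairs {..<n}. ?A i - ?A j)"
    proof (rule schur_prod_mult_sums)
      fix i j assume "(i, j) \<in> pairs {..<n}"
      then have "a j < a i" using a(1) by (auto simp: pairs_def)
      then show "?A i + ?A j \<noteq> 0" by (simp flip: of_nat_add)
    qed
    moreover have "schur_prod ?B {..<n} * (\<Prod>(i, j)\<in>pairs {..<n}. ?B i + ?B j) = (\<Prod>(i, j)\<in>pairs {..<n}. ?B i - ?B j)"
    proof (rule schur_prod_mult_sums)
      fix i j assume "(i, j) \<in> pairs {..<n}"
      then have "b j < b i" using b by (auto simp: pairs_def)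
      then show "?B i + ?B j \<noteq> 0" by (simp flip: of_nat_add)
    qed
    ultimately show ?thesis
      unfolding \<kappa>_def split_value_def by (simp add: prod_dividef mult_ac)
  qed
  finally show ?thesis .
qed

lemma set_interleave_seq: "set (interleave_seq a b I n) \<subseteq> a ` {..<n} \<union> b ` {..<n}"
  by (induction n) (auto simp: interleave_seq_Suc)

text \<open>Only the last \<open>b\<^sub>k\<close> can be \<open>0\<close>, and it is the last entry whether or not the entry before it is
  deleted.\<close>
lemma zero_notin_butlast_interleave_seq:
  assumes "\<And>i. i < n \<Longrightarrow> 0 < a i" "\<And>i j. i < j \<Longrightarrow> j < n \<Longrightarrow> b j < b i"
  shows "0 \<notin> set (butlast (interleave_seq a b I n))"
proof (cases n)
  case (Suc m)
  have "0 \<notin> b ` {..<m}" using assms(2)[of _ m] Suc by fastforce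
  moreover have "0 \<notin> a ` {..<n}" using assms(1) by fastforce
  ultimately show ?thesis
    using set_interleave_seq[of a b I m] Suc by (auto simp: interleave_seq_Suc butlast_append)
qed simp

text \<open>The factorials of \<open>\<alpha>\<^sub>i + 1\<close> in \<open>g_prod\<close> exceed those of \<open>\<alpha>\<^sub>i\<close> in \<open>difference_weight\<close> by the factors
  \<open>a\<^sub>i\<close>, which the product of the \<open>a\<^sub>i\<close> in \<open>split_value\<close> cancels. The index sets for which the sequence has
  a repetition can be included, as their summands vanish for \<open>g_prod\<close>.\<close>
lemma sum_g_bar_seq:
  fixes al be :: "nat list"
  assumes al: "sorted_wrt (>) al" "length al = n" and be: "sorted_wrt (>) be" "length be = n"
  defines "A \<equiv> map (\<lambda>x. x + 1) al"
  shows "(\<Sum>I | I \<subseteq> {..<n} \<and> distinct (interleave_del A be I).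
            g_bar_seq (nths A I) * g_bar_seq (interleave_del A be I)) =
    2 ^ n * (difference_weight al * difference_weight be / (\<Prod>i<n. \<Prod>j<n. real (al ! i) + real (be ! j) + 1))"
proof -
  define a where "a i = Suc (al ! i)" for i
  define b where "b i = be ! i" for i
  have A: "A = map a [0..<n]" and B: "be = map b [0..<n]"
    using al(2) be(2) by (auto simp: A_def a_def[abs_def] b_def[abs_def] intro!: nth_equalityI)
  have il: "interleave_del A be I = interleave_seq a b I n" for I
    unfolding interleave_seq_def A B[symmetric] ..
  have a_dec: "a j < a i" and b_dec: "b j < b i" if "i < j" "j < n" for i j
    using that al be by (auto simp: sorted_wrt_iff_nth_less a_def b_def)
  have "distinct A"
    using al by (auto simp: A_def distinct_map distinct_conv_nth sorted_wrt_iff_nth_less)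
      (metis less_irrefl linorder_neqE_nat)
  have "g_bar_seq (nths A I) * g_bar_seq (interleave_del A be I) =
      g_prod (nths A I) * g_prod (interleave_del A be I)" if "distinct (interleave_del A be I)" for I
  proof -
    have "0 \<notin> set (butlast (nths A I))"
      using in_set_butlastD[of 0 "nths A I"] in_set_nthsD[of 0 A I] by (auto simp: A_def)
    moreover have "0 \<notin> set (butlast (interleave_del A be I))"
      unfolding il by (rule zero_notin_butlast_interleave_seq) (auto simp: a_def b_dec)
    ultimately show ?thesis
      using that \<open>distinct A\<close> by (simp add: g_bar_seq_eq_g_prod distinct_nthsI)
  qed
  then have "(\<Sum>I | I \<subseteq> {..<n} \<and> distinct (interleave_del A be I).
            g_bar_seq (nths A I) * g_bar_seq (interleave_del A be I)) =
      (\<Sum>I | I \<subseteq> {..<n} \<and> distinct (interleave_del A be I). g_prod (nths A I) * g_prod (interleave_del A be I))"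
    by (intro sum.cong) auto
  also have "\<dots> = (\<Sum>I\<in>Pow {..<n}. g_prod (nths A I) * g_prod (interleave_del A be I))"
    by (rule sum.mono_neutral_left) (auto simp: g_prod_not_distinct)
  also have "\<dots> = 2 ^ n * (\<Prod>i<n. real (a i)) *
     ((\<Prod>(i, j)\<in>pairs {..<n}. real (a i) - real (a j)) / (\<Prod>i<n. fact (a i))) *
     ((\<Prod>(i, j)\<in>pairs {..<n}. real (b i) - real (b j)) / (\<Prod>i<n. fact (b i))) /
     (\<Prod>i<n. \<Prod>k<n. real (a i) + real (b k))"
    unfolding il unfolding A by (rule sum_g_prod) (use a_dec b_dec in \<open>auto simp: a_def\<close>)
  also have "(\<Prod>i<n. fact (a i)) = (\<Prod>i<n. real (a i)) * (\<Prod>i<n. fact (al ! i))"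
    by (simp add: a_def prod.distrib)
  also have "2 ^ n * (\<Prod>i<n. real (a i)) *
     ((\<Prod>(i, j)\<in>pairs {..<n}. real (a i) - real (a j)) / ((\<Prod>i<n. real (a i)) * (\<Prod>i<n. fact (al ! i)))) *
     ((\<Prod>(i, j)\<in>pairs {..<n}. real (b i) - real (b j)) / (\<Prod>i<n. fact (b i))) /
     (\<Prod>i<n. \<Prod>k<n. real (a i) + real (b k)) =
    2 ^ n * (difference_weight al * difference_weight be / (\<Prod>i<n. \<Prod>j<n. real (al ! i) + real (be ! j) + 1))"
    by (simp add: difference_weight_def al(2) be(2) a_def b_def add_ac)
  finally show ?thesis .
qed

theorem proposition6:
  fixes mu \<alpha> \<beta> A B C D :: "nat list" and n :: nat
  assumes "is_partition mu"
    and "n = diag_len mu" and "\<alpha> = frob_alpha mu" and "\<beta> = frob_beta mu"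
    and "A = map (\<lambda>x. x + 1) \<alpha>" and "B = \<beta>"
    and "C = map (\<lambda>x. x + 1) \<beta>" and "D = \<alpha>"
  shows "2 ^ n * f_bar mu =
           (\<Sum>I | I \<subseteq> {..<n} \<and> distinct (interleave_del A B I).
              g_bar_seq (nths A I) * g_bar_seq (interleave_del A B I))
       \<and> 2 ^ n * f_bar mu =
           (\<Sum>I | I \<subseteq> {..<n} \<and> distinct (interleave_del C D I).
              g_bar_seq (nths C I) * g_bar_seq (interleave_del C D I))"
proof -
  have \<alpha>: "sorted_wrt (>) \<alpha>" "length \<alpha> = n" and \<beta>: "sorted_wrt (>) \<beta>" "length \<beta> = n"
    using assms(1-4) frob_strict_decreasing[OF assms(1)] by (auto simp: sorted_wrt_iff_nth_less)
  have "(\<Prod>i<n. \<Prod>j<n. real (\<beta> ! i) + real (\<alpha> ! j) + 1) = (\<Prod>i<n. \<Prod>j<n. real (\<alpha> ! i) + real (\<beta> ! j) + 1)"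
    by (subst prod.swap) (simp add: add.commute)
  then show ?thesis
    using sum_g_bar_seq[OF \<alpha> \<beta>] sum_g_bar_seq[OF \<beta> \<alpha>] f_bar_frobenius[OF assms(1)] assms(2-8)
    by (simp add: mult.commute)
qed

end
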